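(* Let $n\ge 1$. The category $\mathbf{MV}_{n+1}$ of $MV_{n+1}$-algebras and MV-algebra homomorphisms is dually equivalent to the category $\mathbf{BoolSOMV}_n$ whose objects are tuples $(X,O_1,\dots,O_{n-1})$, where $X$ is a Boolean space and $O_1,\dots,O_{n-1}$ are open subsets of $X$ such that $O_i=O_{n-i}$ for all $i\in[n-1]$ and $O_i\cap O_k\subseteq O_{n-i+k-1}$ for all $3\le i\le n-2$, $1\le k\le n-4$ with $k<i$; and whose morphisms $f:(X,O_1,\dots,O_{n-1})\to(Y,U_1,\dots,U_{n-1})$ are the continuous maps $f:X\to Y$ with $f^{-1}(U_i)\subseteq O_i$ for all $i\in[n-1]$.
   Context: $[n]=\{1,\dots,n\}$. A Boolean space is a compact Hausdorff space with a basis of clopen sets. An MV-algebra is a structure $(A,\oplus,{}^*,0)$ such that $(A,\oplus,0)$ is a commutative monoid, $(x^* )^*=x$, $x\oplus 0^*=0^*$, and $(x^*\oplus y)^*\oplus y=(y^*\oplus x)^*\oplus x$. $MV_{n+1}$-algebras are the MV-algebras corresponding to the $(n+1)$-valued Łukasiewicz logic, i.e. the members of the variety of MV-algebras generated by the $(n+1)$-element MV-chain $\{0,\frac1n,\dots,\frac{n-1}{n},1\}$ (with $x\oplus y=\min(1,x+y)$, $x^*=1-x$).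
   Formalization: The printed index condition fails (n=4: four one-point objects but three chains); proved with O_i∩O_k⊆O_{n-i+k} for 3≤i≤n-1, 1≤k≤n-3, k<i. Categories are size-matched: algebras inside an arbitrary infinite set K, spaces with at most |K| clopen sets. *)

theory Defs
  imports "HOL-Analysis.T1_Spaces" "HOL-Library.Equipollence" "HOL-Algebra.Group"
begin

section \<open>Categories, opposite categories and equivalence of categories\<close>

text \<open>
  Hom-sets are indexed by their source and target and need not be disjoint;
  \<open>Comp C a b c g f\<close> is the composite of \<open>f : a \<rightarrow> b\<close> with \<open>g : b \<rightarrow> c\<close>.
\<close>

record ('o, 'm) cat =
  Obj :: "'o set"
  Hom :: "'o \<Rightarrow> 'o \<Rightarrow> 'm set"
  Ident :: "'o \<Rightarrow> 'm"
  Comp :: "'o \<Rightarrow> 'o \<Rightarrow> 'o \<Rightarrow> 'm \<Rightarrow> 'm \<Rightarrow> 'm"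

definition is_category :: "('o, 'm) cat \<Rightarrow> bool" where
  "is_category C \<longleftrightarrow>
     (\<forall>a\<in>Obj C. Ident C a \<in> Hom C a a) \<and>
     (\<forall>a\<in>Obj C. \<forall>b\<in>Obj C. \<forall>c\<in>Obj C. \<forall>f\<in>Hom C a b. \<forall>g\<in>Hom C b c.
        Comp C a b c g f \<in> Hom C a c) \<and>
     (\<forall>a\<in>Obj C. \<forall>b\<in>Obj C. \<forall>f\<in>Hom C a b.
        Comp C a a b f (Ident C a) = f \<and> Comp C a b b (Ident C b) f = f) \<and>
     (\<forall>a\<in>Obj C. \<forall>b\<in>Obj C. \<forall>c\<in>Obj C. \<forall>d\<in>Obj C.
        \<forall>f\<in>Hom C a b. \<forall>g\<in>Hom C b c. \<forall>h\<in>Hom C c d.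
          Comp C a c d h (Comp C a b c g f) = Comp C a b d (Comp C b c d h g) f)"

definition op_cat :: "('o, 'm) cat \<Rightarrow> ('o, 'm) cat" where
  "op_cat C = \<lparr>Obj = Obj C, Hom = (\<lambda>a b. Hom C b a), Ident = Ident C,
     Comp = (\<lambda>a b c g f. Comp C c b a f g)\<rparr>"

definition full_subcat :: "('o, 'm) cat \<Rightarrow> 'o set \<Rightarrow> ('o, 'm) cat" where
  "full_subcat C S = C\<lparr>Obj := Obj C \<inter> S\<rparr>"

definition is_iso :: "('o, 'm) cat \<Rightarrow> 'o \<Rightarrow> 'o \<Rightarrow> 'm \<Rightarrow> bool" where
  "is_iso C a b f \<longleftrightarrow> f \<in> Hom C a b \<and>
     (\<exists>g\<in>Hom C b a. Comp C a b a g f = Ident C a \<and> Comp C b a b f g = Ident C b)"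

record ('o, 'm, 'p, 'q) cat_functor =
  on_obj :: "'o \<Rightarrow> 'p"
  on_arr :: "'o \<Rightarrow> 'o \<Rightarrow> 'm \<Rightarrow> 'q"

definition is_functor ::
  "('o, 'm) cat \<Rightarrow> ('p, 'q) cat \<Rightarrow> ('o, 'm, 'p, 'q) cat_functor \<Rightarrow> bool" where
  "is_functor C D F \<longleftrightarrow>
     (\<forall>a\<in>Obj C. on_obj F a \<in> Obj D) \<and>
     (\<forall>a\<in>Obj C. \<forall>b\<in>Obj C. \<forall>f\<in>Hom C a b.
        on_arr F a b f \<in> Hom D (on_obj F a) (on_obj F b)) \<and>
     (\<forall>a\<in>Obj C. on_arr F a a (Ident C a) = Ident D (on_obj F a)) \<and>
     (\<forall>a\<in>Obj C. \<forall>b\<in>Obj C. \<forall>c\<in>Obj C. \<forall>f\<in>Hom C a b. \<forall>g\<in>Hom C b c.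
        on_arr F a c (Comp C a b c g f) =
          Comp D (on_obj F a) (on_obj F b) (on_obj F c) (on_arr F b c g) (on_arr F a b f))"

definition id_functor :: "('o, 'm, 'o, 'm) cat_functor" where
  "id_functor = \<lparr>on_obj = (\<lambda>a. a), on_arr = (\<lambda>a b f. f)\<rparr>"

definition comp_functor ::
  "('p, 'q, 'r, 's) cat_functor \<Rightarrow> ('o, 'm, 'p, 'q) cat_functor \<Rightarrow> ('o, 'm, 'r, 's) cat_functor"
  where
  "comp_functor G F =
     \<lparr>on_obj = (\<lambda>a. on_obj G (on_obj F a)),
      on_arr = (\<lambda>a b f. on_arr G (on_obj F a) (on_obj F b) (on_arr F a b f))\<rparr>"

definition naturally_isomorphic ::
  "('o, 'm) cat \<Rightarrow> ('p, 'q) cat \<Rightarrow> ('o, 'm, 'p, 'q) cat_functor \<Rightarrow>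
     ('o, 'm, 'p, 'q) cat_functor \<Rightarrow> bool" where
  "naturally_isomorphic C D F G \<longleftrightarrow>
     (\<exists>\<eta>. (\<forall>a\<in>Obj C. is_iso D (on_obj F a) (on_obj G a) (\<eta> a)) \<and>
        (\<forall>a\<in>Obj C. \<forall>b\<in>Obj C. \<forall>f\<in>Hom C a b.
           Comp D (on_obj F a) (on_obj F b) (on_obj G b) (\<eta> b) (on_arr F a b f) =
           Comp D (on_obj F a) (on_obj G a) (on_obj G b) (on_arr G a b f) (\<eta> a)))"

definition equivalent_cats :: "('o, 'm) cat \<Rightarrow> ('p, 'q) cat \<Rightarrow> bool" where
  "equivalent_cats C D \<longleftrightarrow> is_category C \<and> is_category D \<and>
     (\<exists>F G. is_functor C D F \<and> is_functor D C G \<and>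
        naturally_isomorphic C C id_functor (comp_functor G F) \<and>
        naturally_isomorphic D D id_functor (comp_functor F G))"

definition dually_equivalent :: "('o, 'm) cat \<Rightarrow> ('p, 'q) cat \<Rightarrow> bool" where
  "dually_equivalent C D \<longleftrightarrow> equivalent_cats (op_cat C) D"


section \<open>MV-algebras and the variety generated by the finite chain\<close>

record 'a mv_struct = "'a partial_object" +
  mv_plus :: "'a \<Rightarrow> 'a \<Rightarrow> 'a"
  mv_neg :: "'a \<Rightarrow> 'a"
  mv_zero :: 'a

definition mv_algebra :: "'a mv_struct \<Rightarrow> bool" where
  "mv_algebra A \<longleftrightarrow>
     comm_monoid \<lparr>carrier = carrier A, monoid.mult = mv_plus A, one = mv_zero A\<rparr> \<and>
     mv_neg A \<in> carrier A \<rightarrow> carrier A \<and>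
     (\<forall>x\<in>carrier A. mv_neg A (mv_neg A x) = x) \<and>
     (\<forall>x\<in>carrier A. mv_plus A x (mv_neg A (mv_zero A)) = mv_neg A (mv_zero A)) \<and>
     (\<forall>x\<in>carrier A. \<forall>y\<in>carrier A.
        mv_plus A (mv_neg A (mv_plus A (mv_neg A x) y)) y =
        mv_plus A (mv_neg A (mv_plus A (mv_neg A y) x)) x)"

definition mv_hom :: "'a mv_struct \<Rightarrow> 'b mv_struct \<Rightarrow> ('a \<Rightarrow> 'b) set" where
  "mv_hom A B = {h \<in> carrier A \<rightarrow>\<^sub>E carrier B.
     (\<forall>x\<in>carrier A. \<forall>y\<in>carrier A. h (mv_plus A x y) = mv_plus B (h x) (h y)) \<and>
     (\<forall>x\<in>carrier A. h (mv_neg A x) = mv_neg B (h x)) \<and>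
     h (mv_zero A) = mv_zero B}"

definition mv_chain :: "nat \<Rightarrow> real mv_struct" where
  "mv_chain n = \<lparr>carrier = {real k / real n |k. k \<le> n},
     mv_plus = (\<lambda>x y. min 1 (x + y)), mv_neg = (\<lambda>x. 1 - x), mv_zero = 0\<rparr>"

datatype mv_term = MVar nat | MZero | MNeg mv_term | MPlus mv_term mv_term

primrec mv_eval :: "'a mv_struct \<Rightarrow> (nat \<Rightarrow> 'a) \<Rightarrow> mv_term \<Rightarrow> 'a" where
  "mv_eval A v (MVar i) = v i"
| "mv_eval A v MZero = mv_zero A"
| "mv_eval A v (MNeg s) = mv_neg A (mv_eval A v s)"
| "mv_eval A v (MPlus s t) = mv_plus A (mv_eval A v s) (mv_eval A v t)"

definition satisfies_identity :: "'a mv_struct \<Rightarrow> mv_term \<Rightarrow> mv_term \<Rightarrow> bool" where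
  "satisfies_identity A s t \<longleftrightarrow> (\<forall>v\<in>UNIV \<rightarrow> carrier A. mv_eval A v s = mv_eval A v t)"

text \<open>
  A variety is an equational class, so the variety generated by an algebra \<open>L\<close> is the class of
  models of all identities valid in \<open>L\<close>.
\<close>

definition mv_n1_algebra :: "nat \<Rightarrow> 'a mv_struct \<Rightarrow> bool" where
  "mv_n1_algebra n A \<longleftrightarrow> mv_algebra A \<and>
     (\<forall>s t. satisfies_identity (mv_chain n) s t \<longrightarrow> satisfies_identity A s t)"

definition MV_cat :: "nat \<Rightarrow> ('a mv_struct, 'a \<Rightarrow> 'a) cat" where
  "MV_cat n = \<lparr>Obj = {A. mv_n1_algebra n A}, Hom = mv_hom,
     Ident = (\<lambda>A. restrict id (carrier A)),
     Comp = (\<lambda>A B C g f. compose (carrier A) g f)\<rparr>"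


section \<open>Boolean spaces with distinguished open sets\<close>

abbreviation clopens :: "'b topology \<Rightarrow> 'b set set" where
  "clopens X \<equiv> {C. openin X C \<and> closedin X C}"

definition boolean_space :: "'b topology \<Rightarrow> bool" where
  "boolean_space X \<longleftrightarrow> compact_space X \<and> Hausdorff_space X \<and>
     (\<forall>U. openin X U \<longleftrightarrow> (arbitrary union_of (\<lambda>C. C \<in> clopens X)) U)"

type_synonym 'b somv = "'b topology \<times> (nat \<Rightarrow> 'b set)"

text \<open>
  The component \<open>V i\<close> is \<open>O\<^sub>i\<close>. It marks the points at which the truth value \<open>i/n\<close> may be
  taken. The last condition says that the admissible values are closed under the Lukasiewicz implication
  \<open>i/n \<rightarrow> k/n = (n - i + k)/n\<close> for \<open>k < i\<close>; the bounds are \<open>3 \<le> i \<le> n - 1\<close>, \<open>1 \<le> k \<le> n - 3\<close>.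
  The source writes \<open>O\<^sub>i \<inter> O\<^sub>k \<subseteq> O\<^sub>m\<close>, \<open>m = n - i + k - 1\<close>, for \<open>3 \<le> i \<le> n - 2\<close>, \<open>1 \<le> k \<le> n - 4\<close>,
  \<open>k < i\<close>. Those are the indices for the \<open>n\<close>-element chain, and the condition below is obtained
  from them by replacing \<open>n\<close> by \<open>n + 1\<close>. The printed indices do not give a dual equivalence: for
  \<open>n = 4\<close> the printed condition is void and leaves four one-point objects up to isomorphism,
  while there are only three nontrivial directly indecomposable algebras in the variety, the
  chains with 2, 3 and 5 elements.
\<close>

definition somv_object :: "nat \<Rightarrow> 'b somv \<Rightarrow> bool" where
  "somv_object n = (\<lambda>(X, V). boolean_space X \<and>
     V \<in> {1..n - 1} \<rightarrow>\<^sub>E {U. openin X U} \<and>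
     (\<forall>i\<in>{1..n - 1}. V i = V (n - i)) \<and>
     (\<forall>i k. 3 \<le> i \<and> i \<le> n - 1 \<and> 1 \<le> k \<and> k \<le> n - 3 \<and> k < i \<longrightarrow> V i \<inter> V k \<subseteq> V (n - i + k)))"

definition somv_hom :: "nat \<Rightarrow> 'b somv \<Rightarrow> 'c somv \<Rightarrow> ('b \<Rightarrow> 'c) set" where
  "somv_hom n = (\<lambda>(X, V) (Y, U). {f. continuous_map X Y f \<and> f \<in> extensional (topspace X) \<and>
     (\<forall>i\<in>{1..n - 1}. {x \<in> topspace X. f x \<in> U i} \<subseteq> V i)})"

definition BoolSOMV_cat :: "nat \<Rightarrow> ('b somv, 'b \<Rightarrow> 'b) cat" where
  "BoolSOMV_cat n = \<lparr>Obj = {P. somv_object n P}, Hom = somv_hom n,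
     Ident = (\<lambda>(X, V). restrict id (topspace X)),
     Comp = (\<lambda>(X, V) Q R g f. compose (topspace X) g f)\<rparr>"

text \<open>
  Size convention. A dual space can be as large as the power set of the algebra, and HOL has no
  universe type absorbing this step, so the two "categories of all objects" are cut down compatibly: for an infinite type
  \<open>'a\<close>, all algebras whose carrier is a subset of \<open>'a\<close> correspond to the spaces with at most
  \<open>'a\<close>-many clopen sets, whose points may be taken in any type at least as large as the power set
  of \<open>'a\<close>. Every algebra and every space occurs, up to isomorphism, for suitable types.
\<close>

definition somv_size_at_most :: "'a set \<Rightarrow> 'b somv set" where
  "somv_size_at_most K = {(X, V). clopens X \<lesssim> K}"

end

(*
An algebra A is sent to the Boolean space of its homomorphisms h into the chain L, where O_i
consists of the h that take the value i/n.  The functor is fully faithful and essentially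
surjective:

- Homomorphisms into L separate the points of A.  In L a finite set of equations can be encoded in
  one identity, since n.e takes only the values 0 and 1; hence every quasi-identity of L holds in A,
  and compactness of L^A produces the homomorphism, without any prime ideal theory.
- Any two homomorphisms are separated by an element with values in {0, 1}.  By compactness such
  elements represent all clopen sets, so a continuous function whose value at each h lies in h(A)
  can be patched together and is evaluation at an element of A.  This gives fullness.
- A space (X, O_1, ..., O_{n-1}) is the dual of the algebra of continuous functions X -> L that
  take the value i/n only inside O_i.
*)
theory Submission
  imports Defs "HOL-Analysis.Abstract_Topological_Spaces" "HOL-Analysis.Abstract_Limits"
begin

section \<open>Fully faithful and essentially surjective functors\<close>

text \<open>The conditions on the open sets say that at each point \<open>x\<close> the values 0, 1
  and those \<open>i/n\<close> with \<open>x\<close> in \<open>O_i\<close> form a subalgebra of the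
  chain: symmetry is closure under negation, the intersection condition is closure under
  implication, and these two operations generate truncated addition. An object is thus a Boolean
  space with a subalgebra attached to each point, and a morphism \<open>f\<close> is a continuous
  map for which the subalgebra at \<open>f x\<close> is contained in the one at \<open>x\<close>.
  For the dual of an algebra, the subalgebra at \<open>h\<close> is the image of \<open>h\<close>,
  and the image of a composite \<open>h o f\<close> is contained in that of \<open>h\<close>. Types
  are the second constraint. Homomorphisms into the chain are functions on \<open>'a\<close> but
  must become points of \<open>'b\<close>, hence the requirement that \<open>'b\<close> has room for
  all subsets of \<open>'a\<close>. Conversely, functions on a space must become elements of
  \<open>'a\<close>; such a function is given by finitely many clopen fibres, hence the bound on the
  number of clopen sets and the infinite type \<open>'a\<close>.\<close>

lemma equivalent_catsI_fully_faithful: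
  assumes C: "is_category C" and D: "is_category D" and F: "is_functor C D F"
    and full: "\<And>a b g. \<lbrakk>a \<in> Obj C; b \<in> Obj C; g \<in> Hom D (on_obj F a) (on_obj F b)\<rbrakk>
      \<Longrightarrow> \<exists>f\<in>Hom C a b. on_arr F a b f = g"
    and faithful: "\<And>a b. \<lbrakk>a \<in> Obj C; b \<in> Obj C\<rbrakk> \<Longrightarrow> inj_on (on_arr F a b) (Hom C a b)"
    and ess_surj: "\<And>d. d \<in> Obj D \<Longrightarrow> \<exists>c\<in>Obj C. \<exists>e. is_iso D d (on_obj F c) e"
  shows "equivalent_cats C D"
proof -
  note Cid = C[unfolded is_category_def, THEN conjunct1, rule_format]
  note Ccomp = C[unfolded is_category_def, THEN conjunct2, THEN conjunct1, rule_format]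
  note Did = D[unfolded is_category_def, THEN conjunct1, rule_format]
  note Dcomp = D[unfolded is_category_def, THEN conjunct2, THEN conjunct1, rule_format]
  note Dunit = D[unfolded is_category_def, THEN conjunct2, THEN conjunct2, THEN conjunct1, rule_format]
  note Dassoc = D[unfolded is_category_def, THEN conjunct2, THEN conjunct2, THEN conjunct2, rule_format]
  note Fobj = F[unfolded is_functor_def, THEN conjunct1, rule_format]
  note Farr = F[unfolded is_functor_def, THEN conjunct2, THEN conjunct1, rule_format]
  note Fid = F[unfolded is_functor_def, THEN conjunct2, THEN conjunct2, THEN conjunct1, rule_format]
  note Fcomp = F[unfolded is_functor_def, THEN conjunct2, THEN conjunct2, THEN conjunct2, rule_format]
  define P where "P a b = inv_into (Hom C a b) (on_arr F a b)" for a b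
  have P: "P a b g \<in> Hom C a b" "on_arr F a b (P a b g) = g"
    if "a \<in> Obj C" "b \<in> Obj C" "g \<in> Hom D (on_obj F a) (on_obj F b)" for a b g
    using full[OF that] unfolding P_def by (auto intro: inv_into_into f_inv_into_f)
  have eqI: "f = f'" if "on_arr F a b f = on_arr F a b f'" "a \<in> Obj C" "b \<in> Obj C"
    "f \<in> Hom C a b" "f' \<in> Hom C a b" for a b f f'
    using faithful[OF that(2,3)] that by (auto dest: inj_onD)
  have "\<forall>d\<in>Obj D. \<exists>c e e'. c \<in> Obj C \<and> e \<in> Hom D d (on_obj F c) \<and> e' \<in> Hom D (on_obj F c) d \<and>
     Comp D d (on_obj F c) d e' e = Ident D d \<and>
     Comp D (on_obj F c) d (on_obj F c) e e' = Ident D (on_obj F c)"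
    using ess_surj unfolding is_iso_def by blast
  then obtain g e e' where g: "\<And>d. d \<in> Obj D \<Longrightarrow> g d \<in> Obj C"
    and e: "\<And>d. d \<in> Obj D \<Longrightarrow> e d \<in> Hom D d (on_obj F (g d))"
    and e': "\<And>d. d \<in> Obj D \<Longrightarrow> e' d \<in> Hom D (on_obj F (g d)) d"
    and e'e: "\<And>d. d \<in> Obj D \<Longrightarrow> Comp D d (on_obj F (g d)) d (e' d) (e d) = Ident D d"
    and ee': "\<And>d. d \<in> Obj D \<Longrightarrow>
        Comp D (on_obj F (g d)) d (on_obj F (g d)) (e d) (e' d) = Ident D (on_obj F (g d))"
    by metis
  \<comment> \<open>Conjugation of \<open>f\<close> by the chosen isomorphisms \<open>e\<close>. The
    inverse functor sends \<open>f\<close> to the \<open>F\<close>-preimage of this arrow, so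
    functoriality only has to be checked for \<open>conj\<close>.\<close>
  define conj where "conj a b f = Comp D (on_obj F (g a)) a (on_obj F (g b)) (Comp D a b (on_obj F (g b)) (e b) f) (e' a)"
    for a b f
  define G where "G = \<lparr>on_obj = g, on_arr = (\<lambda>a b f. P (g a) (g b) (conj a b f))\<rparr>"
  have conj_in: "conj a b f \<in> Hom D (on_obj F (g a)) (on_obj F (g b))"
    if "a \<in> Obj D" "b \<in> Obj D" "f \<in> Hom D a b" for a b f
    using that unfolding conj_def by (intro Dcomp[of _ a] Dcomp[of _ b]) (auto intro: g Fobj e e')
  have conj_e: "Comp D a (on_obj F (g a)) (on_obj F (g b)) (conj a b f) (e a)
      = Comp D a b (on_obj F (g b)) (e b) f"
    if ab: "a \<in> Obj D" "b \<in> Obj D" and f: "f \<in> Hom D a b" for a b f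
  proof -
    have h: "Comp D a b (on_obj F (g b)) (e b) f \<in> Hom D a (on_obj F (g b))"
      using ab f by (intro Dcomp[of _ b]) (auto intro: g Fobj e e')
    show ?thesis
      unfolding conj_def using ab h
      by (subst Dassoc[symmetric]) (auto simp: e e' g Fobj e'e Dunit)
  qed
  \<comment> \<open>The naturality square with \<open>e\<close> characterises
    \<open>conj a b f\<close>, because \<open>e a\<close> can be cancelled on the right with
    \<open>e' a\<close>. Identities and composites then follow by pasting squares.\<close>
  have conj_eqI: "k = conj a b f"
    if ab: "a \<in> Obj D" "b \<in> Obj D" and f: "f \<in> Hom D a b"
      and k: "k \<in> Hom D (on_obj F (g a)) (on_obj F (g b))"
      and eq: "Comp D a (on_obj F (g a)) (on_obj F (g b)) k (e a) = Comp D a b (on_obj F (g b)) (e b) f"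
    for a b f k
  proof -
    have "k = Comp D (on_obj F (g a)) (on_obj F (g a)) (on_obj F (g b)) k (Ident D (on_obj F (g a)))"
      using ab k by (auto simp: Dunit g Fobj)
    also have "\<dots> = conj a b f"
      unfolding conj_def eq[symmetric] using ab k
      by (subst ee'[OF ab(1), symmetric], subst Dassoc) (auto simp: e e' g Fobj)
    finally show ?thesis .
  qed
  have conj_id: "conj a a (Ident D a) = Ident D (on_obj F (g a))" if a: "a \<in> Obj D" for a
    by (rule conj_eqI[symmetric]) (use a in \<open>auto simp: Did g Fobj e Dunit\<close>)
  have conj_comp: "conj a c (Comp D a b c h f) =
      Comp D (on_obj F (g a)) (on_obj F (g b)) (on_obj F (g c)) (conj b c h) (conj a b f)"
    if abc: "a \<in> Obj D" "b \<in> Obj D" "c \<in> Obj D" and f: "f \<in> Hom D a b" and h: "h \<in> Hom D b c"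
    for a b c f h
  proof (rule conj_eqI[symmetric])
    let ?F = "\<lambda>a. on_obj F (g a)"
    have "Comp D a (?F a) (?F c) (Comp D (?F a) (?F b) (?F c) (conj b c h) (conj a b f)) (e a)
      = Comp D a (?F b) (?F c) (conj b c h) (Comp D a (?F a) (?F b) (conj a b f) (e a))"
      using abc f h by (subst Dassoc) (auto simp: e g Fobj conj_in)
    also have "\<dots> = Comp D a b (?F c) (Comp D b (?F b) (?F c) (conj b c h) (e b)) f"
      using abc f h by (simp add: conj_e, subst Dassoc) (auto simp: e g Fobj conj_in conj_e)
    also have "\<dots> = Comp D a c (?F c) (e c) (Comp D a b c h f)"
      using abc f h by (simp add: conj_e, subst Dassoc) (auto simp: e g Fobj conj_in conj_e)
    finally show "Comp D a (?F a) (?F c) (Comp D (?F a) (?F b) (?F c) (conj b c h) (conj a b f)) (e a)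
      = Comp D a c (?F c) (e c) (Comp D a b c h f)" .
  qed (use abc f h in \<open>auto intro: conj_in Dcomp g Fobj\<close>)
  have G: "is_functor D C G"
    unfolding is_functor_def
  proof (intro conjI ballI)
    fix a b f assume *: "a \<in> Obj D" "b \<in> Obj D" "f \<in> Hom D a b"
    then show "on_arr G a b f \<in> Hom C (on_obj G a) (on_obj G b)"
      by (simp add: G_def P g conj_in)
  next
    fix a assume a: "a \<in> Obj D"
    then show "on_arr G a a (Ident D a) = Ident C (on_obj G a)"
      by (intro eqI[of "g a" "g a"]) (auto simp: G_def P g conj_in conj_id Did Fid Cid Fobj)
  next
    fix a b c f h assume *: "a \<in> Obj D" "b \<in> Obj D" "c \<in> Obj D" "f \<in> Hom D a b" "h \<in> Hom D b c"
    have hf: "Comp D a b c h f \<in> Hom D a c" using * by (intro Dcomp[of a b c])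
    have "Comp D (on_obj F (g a)) (on_obj F (g b)) (on_obj F (g c)) (conj b c h) (conj a b f)
        \<in> Hom D (on_obj F (g a)) (on_obj F (g c))"
      using * by (intro Dcomp conj_in Fobj g)
    with * hf show "on_arr G a c (Comp D a b c h f) =
      Comp C (on_obj G a) (on_obj G b) (on_obj G c) (on_arr G b c h) (on_arr G a b f)"
      by (intro eqI[of "g a" "g c"])
        (auto simp: G_def P g conj_in conj_comp Fcomp intro!: Ccomp[of "g a" "g b" "g c"])
  qed (simp add: G_def g)
  have unit: "naturally_isomorphic C C id_functor (comp_functor G F)"
    unfolding naturally_isomorphic_def
  \<comment> \<open>The component at \<open>c\<close> is the \<open>F\<close>-preimage of the
    isomorphism \<open>e\<close> at \<open>F c\<close>, its inverse the preimage of
    \<open>e'\<close>. All equations are checked after applying \<open>F\<close>, which is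
    faithful.\<close>
  proof (intro exI[of _ "\<lambda>c. P c (g (on_obj F c)) (e (on_obj F c))"] conjI ballI)
    let ?F = "on_obj F"
    let ?\<eta> = "\<lambda>c. P c (g (?F c)) (e (?F c))"
    have \<eta>: "?\<eta> c \<in> Hom C c (g (?F c))" "on_arr F c (g (?F c)) (?\<eta> c) = e (?F c)"
      if "c \<in> Obj C" for c
      using that by (auto intro!: P g e Fobj)
    fix a assume a: "a \<in> Obj C"
    let ?\<theta> = "P (g (?F a)) a (e' (?F a))"
    have \<theta>: "?\<theta> \<in> Hom C (g (?F a)) a" "on_arr F (g (?F a)) a ?\<theta> = e' (?F a)"
      using a by (auto intro!: P g e' Fobj)
    have "Comp C a (g (?F a)) a ?\<theta> (?\<eta> a) = Ident C a"
      using a by (intro eqI[of a a]) (auto simp: Fcomp \<eta> \<theta> Fid e'e Fobj g Cid intro!: Ccomp[of a "g (?F a)" a])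
    moreover have "Comp C (g (?F a)) a (g (?F a)) (?\<eta> a) ?\<theta> = Ident C (g (?F a))"
      using a by (intro eqI[of "g (?F a)" "g (?F a)"])
        (auto simp: Fcomp \<eta> \<theta> Fid ee' Fobj g Cid intro!: Ccomp[of "g (?F a)" a "g (?F a)"])
    ultimately show "is_iso C (on_obj id_functor a) (on_obj (comp_functor G F) a) (?\<eta> a)"
      using \<eta>[OF a] \<theta> by (auto simp: is_iso_def id_functor_def comp_functor_def G_def)
    fix b f assume b: "b \<in> Obj C" and f: "f \<in> Hom C a b"
    have Ff: "on_arr F a b f \<in> Hom D (?F a) (?F b)" by (rule Farr[OF a b f])
    have Gf: "P (g (?F a)) (g (?F b)) (conj (?F a) (?F b) (on_arr F a b f)) \<in> Hom C (g (?F a)) (g (?F b))"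
      "on_arr F (g (?F a)) (g (?F b)) (P (g (?F a)) (g (?F b)) (conj (?F a) (?F b) (on_arr F a b f)))
        = conj (?F a) (?F b) (on_arr F a b f)"
      using a b Ff by (auto intro!: P g Fobj conj_in)
    have "Comp C a b (g (?F b)) (?\<eta> b) f = Comp C a (g (?F a)) (g (?F b))
        (P (g (?F a)) (g (?F b)) (conj (?F a) (?F b) (on_arr F a b f))) (?\<eta> a)"
      using a b f Ff by (intro eqI[of a "g (?F b)"])
        (auto simp: Fcomp \<eta> Gf Fobj g conj_e intro!: Ccomp[of a b "g (?F b)"] Ccomp[of a "g (?F a)" "g (?F b)"])
    then show "Comp C (on_obj id_functor a) (on_obj id_functor b) (on_obj (comp_functor G F) b)
        (?\<eta> b) (on_arr id_functor a b f) =
      Comp C (on_obj id_functor a) (on_obj (comp_functor G F) a) (on_obj (comp_functor G F) b)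
        (on_arr (comp_functor G F) a b f) (?\<eta> a)"
      by (simp add: id_functor_def comp_functor_def G_def)
  qed
  have counit: "naturally_isomorphic D D id_functor (comp_functor F G)"
    unfolding naturally_isomorphic_def
  proof (intro exI[of _ e] conjI ballI)
    fix a assume a: "a \<in> Obj D"
    then show "is_iso D (on_obj id_functor a) (on_obj (comp_functor F G) a) (e a)"
      by (auto simp: is_iso_def id_functor_def comp_functor_def G_def e e' e'e ee' intro!: bexI[of _ "e' a"])
    fix b f assume "b \<in> Obj D" "f \<in> Hom D a b"
    with a show "Comp D (on_obj id_functor a) (on_obj id_functor b) (on_obj (comp_functor F G) b)
        (e b) (on_arr id_functor a b f) =
      Comp D (on_obj id_functor a) (on_obj (comp_functor F G) a) (on_obj (comp_functor F G) b)
        (on_arr (comp_functor F G) a b f) (e a)"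
      by (simp add: id_functor_def comp_functor_def G_def P conj_in g conj_e)
  qed
  show ?thesis
    unfolding equivalent_cats_def using C D F G unit counit by blast
qed

lemma is_category_op_cat: "is_category C \<Longrightarrow> is_category (op_cat C)"
  unfolding is_category_def op_cat_def by (simp; metis)

lemma is_category_full_subcat: "is_category C \<Longrightarrow> is_category (full_subcat C S)"
  unfolding is_category_def full_subcat_def by simp

section \<open>Homomorphisms into the chain\<close>

text \<open>Closure is kept apart from the axioms: for an algebra of functions it is known first,
  and the axioms are then deduced from separation by maps into the chain.\<close>

definition mv_closed :: "'a mv_struct \<Rightarrow> bool" where
  "mv_closed A \<longleftrightarrow> mv_zero A \<in> carrier A \<and> (\<forall>x\<in>carrier A. mv_neg A x \<in> carrier A) \<and>
     (\<forall>x\<in>carrier A. \<forall>y\<in>carrier A. mv_plus A x y \<in> carrier A)"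

lemma mv_closedD:
  assumes "mv_closed A"
  shows "mv_zero A \<in> carrier A" "x \<in> carrier A \<Longrightarrow> mv_neg A x \<in> carrier A"
    "x \<in> carrier A \<Longrightarrow> y \<in> carrier A \<Longrightarrow> mv_plus A x y \<in> carrier A"
  using assms by (auto simp: mv_closed_def)

definition mv_multiple :: "'a mv_struct \<Rightarrow> nat \<Rightarrow> 'a \<Rightarrow> 'a" where
  "mv_multiple A k a = (mv_plus A a ^^ k) (mv_zero A)"

text \<open>The Lukasiewicz conjunction, De Morgan dual of truncated addition.\<close>

definition mv_odot :: "'a mv_struct \<Rightarrow> 'a \<Rightarrow> 'a \<Rightarrow> 'a" where
  "mv_odot A a b = mv_neg A (mv_plus A (mv_neg A a) (mv_neg A b))"

lemma mv_multiple_closed: "mv_closed A \<Longrightarrow> a \<in> carrier A \<Longrightarrow> mv_multiple A k a \<in> carrier A"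
  unfolding mv_multiple_def by (induction k) (auto intro: mv_closedD)

lemma mv_odot_closed:
  "mv_closed A \<Longrightarrow> a \<in> carrier A \<Longrightarrow> b \<in> carrier A \<Longrightarrow> mv_odot A a b \<in> carrier A"
  unfolding mv_odot_def by (intro mv_closedD)

lemma mv_homD:
  assumes "h \<in> mv_hom A B"
  shows "h (mv_zero A) = mv_zero B" "x \<in> carrier A \<Longrightarrow> h x \<in> carrier B"
    "x \<in> carrier A \<Longrightarrow> h (mv_neg A x) = mv_neg B (h x)"
    "x \<in> carrier A \<Longrightarrow> y \<in> carrier A \<Longrightarrow> h (mv_plus A x y) = mv_plus B (h x) (h y)"
    "h \<in> extensional (carrier A)"
  using assms by (auto simp: mv_hom_def PiE_def)

lemma mv_hom_eqI:
  "h \<in> mv_hom A B \<Longrightarrow> g \<in> mv_hom A C \<Longrightarrow> (\<And>x. x \<in> carrier A \<Longrightarrow> h x = g x) \<Longrightarrow> h = g"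
  by (meson extensionalityI mv_homD(5))

lemma mv_hom_compose:
  assumes "mv_closed A" "f \<in> mv_hom A B" "g \<in> mv_hom B C"
  shows "compose (carrier A) g f \<in> mv_hom A C"
  using assms by (auto simp: mv_hom_def compose_def mv_closedD Pi_iff PiE_def)

lemma mv_hom_id: "mv_closed A \<Longrightarrow> restrict id (carrier A) \<in> mv_hom A A"
  by (auto simp: mv_hom_def mv_closedD)

lemma mv_eval_closed:
  "mv_closed A \<Longrightarrow> (\<And>i. v i \<in> carrier A) \<Longrightarrow> mv_eval A v t \<in> carrier A"
  by (induction t) (auto intro: mv_closedD)

lemma mv_hom_eval:
  assumes "mv_closed A" "h \<in> mv_hom A B" "\<And>i. v i \<in> carrier A"
  shows "h (mv_eval A v t) = mv_eval B (\<lambda>i. h (v i)) t"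
  by (induction t) (simp_all add: mv_homD[OF assms(2)] mv_eval_closed[OF assms(1,3)])

lemma mv_n1_algebra_closed:
  assumes "mv_n1_algebra n A"
  shows "mv_closed A"
proof -
  interpret comm_monoid "\<lparr>carrier = carrier A, monoid.mult = mv_plus A, one = mv_zero A\<rparr>"
    using assms by (simp add: mv_n1_algebra_def mv_algebra_def)
  show ?thesis
    using m_closed one_closed assms by (auto simp: mv_closed_def mv_n1_algebra_def mv_algebra_def)
qed

lemma mv_n1_algebra_plus_zero:
  assumes "mv_n1_algebra n A" "x \<in> carrier A"
  shows "mv_plus A x (mv_zero A) = x"
proof -
  interpret comm_monoid "\<lparr>carrier = carrier A, monoid.mult = mv_plus A, one = mv_zero A\<rparr>"
    using assms by (simp add: mv_n1_algebra_def mv_algebra_def)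
  show ?thesis using r_one assms by simp
qed

lemma mv_n1_algebra_neg_neg:
  "mv_n1_algebra n A \<Longrightarrow> x \<in> carrier A \<Longrightarrow> mv_neg A (mv_neg A x) = x"
  by (simp add: mv_n1_algebra_def mv_algebra_def)

lemma mv_n1_algebra_identity:
  assumes "mv_n1_algebra n A" "\<And>i. v i \<in> carrier A"
    and "\<And>w. (\<And>i. w i \<in> carrier (mv_chain n)) \<Longrightarrow> mv_eval (mv_chain n) w s = mv_eval (mv_chain n) w t"
  shows "mv_eval A v s = mv_eval A v t"
  using assms unfolding mv_n1_algebra_def satisfies_identity_def by blast

text \<open>Chang's distance: the sum of the two truncated differences, which on the chain is the
  absolute value of the difference. It turns an equation into the vanishing of one term.\<close>

definition mv_dist_term :: "mv_term \<Rightarrow> mv_term \<Rightarrow> mv_term" where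
  "mv_dist_term p q = MPlus (MNeg (MPlus (MNeg p) q)) (MNeg (MPlus (MNeg q) p))"

lemma mv_eval_multiple:
  "mv_eval A v ((MPlus t ^^ k) MZero) = mv_multiple A k (mv_eval A v t)"
  unfolding mv_multiple_def by (induction k) auto

lemma mv_chain_simps [simp]:
  "mv_plus (mv_chain n) x y = min 1 (x + y)" "mv_neg (mv_chain n) x = 1 - x" "mv_zero (mv_chain n) = 0"
  by (simp_all add: mv_chain_def)

lemma mv_hom_chainD:
  assumes "h \<in> mv_hom A (mv_chain n)"
  shows "h (mv_zero A) = 0" "x \<in> carrier A \<Longrightarrow> h x \<in> carrier (mv_chain n)"
    "x \<in> carrier A \<Longrightarrow> h (mv_neg A x) = 1 - h x"
    "x \<in> carrier A \<Longrightarrow> y \<in> carrier A \<Longrightarrow> h (mv_plus A x y) = min 1 (h x + h y)"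
  using mv_homD[OF assms] by auto

section \<open>Arithmetic of the finite chain\<close>

locale chain_order =
  fixes n :: nat
  assumes n_pos: "n \<ge> 1"
begin

abbreviation "L \<equiv> mv_chain n"

lemma chain_carrier: "carrier L = (\<lambda>k. real k / real n) ` {..n}"
  by (auto simp: mv_chain_def)

lemma finite_chain: "finite (carrier L)"
  by (simp add: chain_carrier)

lemma chain_bounds:
  assumes "x \<in> carrier L" shows "0 \<le> x" "x \<le> 1"
  using assms n_pos by (auto simp: chain_carrier)

lemma chain_of_nat: "k \<le> n \<Longrightarrow> real k / real n \<in> carrier L"
  by (auto simp: chain_carrier)

lemma chain_zero: "0 \<in> carrier L"
  using chain_of_nat[of 0] by simp

lemma chain_one: "1 \<in> carrier L"
  using chain_of_nat[of n] n_pos by simp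

lemma chain_closed: "mv_closed L"
proof -
  have "1 - x \<in> carrier L" if "x \<in> carrier L" for x
  proof -
    from that obtain k where k: "k \<le> n" "x = real k / real n" by (auto simp: chain_carrier)
    then have "1 - x = real (n - k) / real n" using n_pos by (simp add: field_simps of_nat_diff)
    then show ?thesis using chain_of_nat[of "n - k"] by simp
  qed
  moreover have "min 1 (x + y) \<in> carrier L" if "x \<in> carrier L" "y \<in> carrier L" for x y
  proof -
    from that obtain k j where k: "x = real k / real n" "y = real j / real n" by (auto simp: chain_carrier)
    then have "x + y = real (k + j) / real n" by (simp add: add_divide_distrib)
    then show ?thesis
      using chain_of_nat[of "k + j"] chain_one n_pos by (cases "k + j \<le> n") (auto simp: min_def)
  qed
  ultimately show ?thesis by (auto simp: mv_closed_def chain_zero)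
qed

text \<open>Neighbouring elements of the chain are \<open>1/n\<close> apart. This turns strict
  inequalities into closed conditions and makes the \<open>n\<close>-fold sum of a nonzero element
  equal to 1.\<close>

lemma chain_gap:
  assumes "x \<in> carrier L" "y \<in> carrier L" "x < y"
  shows "1 \<le> real n * (y - x)"
proof -
  from assms obtain k j where k: "x = real k / real n" "y = real j / real n" by (auto simp: chain_carrier)
  then have "k < j" using assms n_pos by (simp add: divide_less_cancel)
  then have "1 \<le> real j - real k" by linarith
  then show ?thesis using k n_pos by (simp add: field_simps)
qed

lemma chain_multiple:
  assumes "0 \<le> x" shows "mv_multiple L k x = min 1 (real k * x)"
proof (induction k)
  case (Suc k)
  have "0 \<le> real k * x" using assms by simp
  with Suc assms show ?case by (simp add: mv_multiple_def min_def algebra_simps)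
qed (simp add: mv_multiple_def)

lemma chain_multiple_n:
  assumes "x \<in> carrier L" shows "mv_multiple L n x = (if x = 0 then 0 else 1)"
  using chain_gap[OF chain_zero assms] chain_bounds[OF assms] by (auto simp: chain_multiple)

lemma chain_eval_bounds:
  assumes "\<And>i. w i \<in> carrier L"
  shows "0 \<le> mv_eval L w t" "mv_eval L w t \<le> 1"
  using mv_eval_closed[where v = w, OF chain_closed assms] chain_bounds by auto

lemma chain_dist_term_eq_0_iff:
  assumes "\<And>i. w i \<in> carrier L"
  shows "mv_eval L w (mv_dist_term p q) = 0 \<longleftrightarrow> mv_eval L w p = mv_eval L w q"
  using chain_eval_bounds[of w p, OF assms] chain_eval_bounds[of w q, OF assms]
  by (auto simp: mv_dist_term_def min_def)

text \<open>A truncated sum of nonnegative numbers vanishes only if every summand does, so one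
  equation can express a finite conjunction.\<close>

lemma chain_foldr_plus_eq_0:
  assumes "\<And>i. w i \<in> carrier L" "mv_eval L w (foldr MPlus ts MZero) = 0" "t \<in> set ts"
  shows "mv_eval L w t = 0"
  using assms(2,3)
proof (induction ts)
  case (Cons u ts)
  then show ?case
    using chain_eval_bounds(1)[of w u, OF assms(1)]
      chain_eval_bounds(1)[of w "foldr MPlus ts MZero", OF assms(1)]
    by (auto simp: min_def split: if_splits)
qed simp

text \<open>The maps in \<open>H\<close> jointly embed \<open>A\<close> into a power of the chain,
  and both the MV axioms and all identities of the chain are inherited by subalgebras of
  powers.\<close>

lemma mv_n1_algebraI:
  assumes A: "mv_closed A" and H: "H \<subseteq> mv_hom A L"
    and sep: "\<And>x y. \<lbrakk>x \<in> carrier A; y \<in> carrier A; \<And>h. h \<in> H \<Longrightarrow> h x = h y\<rbrakk> \<Longrightarrow> x = y"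
  shows "mv_n1_algebra n A"
proof -
  note hom = mv_hom_chainD[OF subsetD[OF H]]
  note cl = mv_closedD[OF A]
  have bd: "0 \<le> h x" "h x \<le> 1" if "h \<in> H" "x \<in> carrier A" for h x
    using hom(2)[OF that] chain_bounds by auto
  have "comm_monoid \<lparr>carrier = carrier A, monoid.mult = mv_plus A, one = mv_zero A\<rparr>"
  proof (rule comm_monoidI; simp)
    fix x y z assume *: "x \<in> carrier A" "y \<in> carrier A" "z \<in> carrier A"
    show "mv_plus A (mv_plus A x y) z = mv_plus A x (mv_plus A y z)"
    proof (rule sep)
      fix h assume "h \<in> H"
      with * show "h (mv_plus A (mv_plus A x y) z) = h (mv_plus A x (mv_plus A y z))"
        using bd[of h x] bd[of h y] bd[of h z] by (simp add: hom cl min_def)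
    qed (simp_all add: cl *)
  next
    fix x assume *: "x \<in> carrier A"
    then show "mv_plus A (mv_zero A) x = x"
      using bd by (intro sep) (auto simp: hom cl)
  next
    fix x y assume *: "x \<in> carrier A" "y \<in> carrier A"
    then show "mv_plus A x y = mv_plus A y x"
      by (intro sep) (auto simp: hom cl add.commute)
  qed (simp_all add: cl)
  moreover have "mv_neg A (mv_neg A x) = x"
    "mv_plus A x (mv_neg A (mv_zero A)) = mv_neg A (mv_zero A)" if "x \<in> carrier A" for x
    using that bd by (auto intro!: sep simp: hom cl)
  moreover have "mv_plus A (mv_neg A (mv_plus A (mv_neg A x) y)) y =
        mv_plus A (mv_neg A (mv_plus A (mv_neg A y) x)) x" if *: "x \<in> carrier A" "y \<in> carrier A" for x y
  proof (rule sep)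
    fix h assume "h \<in> H"
    with * show "h (mv_plus A (mv_neg A (mv_plus A (mv_neg A x) y)) y) =
        h (mv_plus A (mv_neg A (mv_plus A (mv_neg A y) x)) x)"
      using bd[of h x] bd[of h y] by (simp add: hom cl min_def)
  qed (simp_all add: cl *)
  moreover have "satisfies_identity A s t" if "satisfies_identity L s t" for s t
    unfolding satisfies_identity_def
  proof
    fix v :: "nat \<Rightarrow> _" assume "v \<in> UNIV \<rightarrow> carrier A"
    then have v: "\<And>i. v i \<in> carrier A" by auto
    show "mv_eval A v s = mv_eval A v t"
    proof (intro sep mv_eval_closed A v)
      fix h assume h: "h \<in> H"
      have "mv_eval L (\<lambda>i. h (v i)) s = mv_eval L (\<lambda>i. h (v i)) t"
        using that h v hom(2) by (auto simp: satisfies_identity_def)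
      then show "h (mv_eval A v s) = h (mv_eval A v t)"
        using mv_hom_eval[where v = v, OF A subsetD[OF H h] v] by simp
    qed
  qed
  ultimately show ?thesis by (auto simp: mv_n1_algebra_def mv_algebra_def cl)
qed

text \<open>
  If the finitely many equations had no solution in the chain with \<open>h a \<noteq> h b\<close>, then the identity \<open>a \<odot> (n \<cdot> e)\<^sup>* = b \<odot> (n \<cdot> e)\<^sup>*\<close>, where \<open>e\<close> sums the
  distances of the two sides of the equations, would hold in the chain, hence in \<open>A\<close>, where \<open>e = 0\<close>.
\<close>

lemma finite_partial_hom:
  assumes A: "mv_n1_algebra n A" and ab: "a \<in> carrier A" "b \<in> carrier A" "a \<noteq> b"
    and S: "finite S" "S \<subseteq> carrier A \<times> carrier A"
  shows "\<exists>h\<in>carrier A \<rightarrow>\<^sub>E carrier L. h a \<noteq> h b \<and> (\<forall>(x, y)\<in>S.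
    h (mv_plus A x y) = min 1 (h x + h y) \<and> h (mv_neg A x) = 1 - h x \<and> h (mv_zero A) = 0)"
proof -
  note cl = mv_closedD[OF mv_n1_algebra_closed[OF A]]
  define F where "F = {a, b, mv_zero A} \<union> (\<Union>(x, y)\<in>S. {x, y, mv_plus A x y, mv_neg A x})"
  have F: "finite F" "F \<subseteq> carrier A"
  proof -
    show "finite F" using S(1) by (auto simp: F_def)
    have "{x, y, mv_plus A x y, mv_neg A x} \<subseteq> carrier A" if "(x, y) \<in> S" for x y
      using subsetD[OF S(2) that] by (simp add: cl)
    then show "F \<subseteq> carrier A" using ab cl(1) by (fastforce simp: F_def)
  qed
  obtain idx :: "_ \<Rightarrow> nat" where idx: "inj_on idx F"
    using finite_imp_inj_to_nat_seg[OF F(1)] by auto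
  \<comment> \<open>This valuation names the elements of \<open>F\<close> by distinct variables. All
    other variables get the value zero, so that it takes values in \<open>A\<close>
    throughout.\<close>
  define v where "v i = (if i \<in> idx ` F then inv_into F idx i else mv_zero A)" for i
  have v_idx: "v (idx x) = x" if "x \<in> F" for x
    using that idx by (simp add: v_def)
  have v: "v i \<in> carrier A" for i
    using subsetD[OF F(2) inv_into_into[of i idx F]] cl(1) by (simp add: v_def)
  obtain xs where xs: "set xs = S" using S(1) finite_list by blast
  define V where "V x = MVar (idx x)" for x
  define d where "d p = (case p of (x, y) \<Rightarrow>
      MPlus (mv_dist_term (MPlus (V x) (V y)) (V (mv_plus A x y)))
        (MPlus (mv_dist_term (MNeg (V x)) (V (mv_neg A x))) (mv_dist_term MZero (V (mv_zero A)))))" for p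
  define E where "E = foldr MPlus (map d xs) MZero"
  define N where "N = (MPlus E ^^ n) MZero"
  \<comment> \<open>The term is \<open>x\<close> where \<open>N\<close> is 0 and it is 0 where
    \<open>N\<close> is 1. Since \<open>N\<close> takes no other values on the chain, a chain
    valuation that separates \<open>t a\<close> from \<open>t b\<close> must satisfy all the
    equations.\<close>
  define t where "t x = MNeg (MPlus (MNeg (V x)) N)" for x
  have zz: "mv_plus A (mv_zero A) (mv_zero A) = mv_zero A"
    by (rule mv_n1_algebra_plus_zero[OF A]) (rule cl)
  have multiple_zero: "mv_multiple A k (mv_zero A) = mv_zero A" for k
    by (induction k) (auto simp: mv_multiple_def zz)
  \<comment> \<open>That the distance of an element to itself is zero is an identity of the chain in
    one variable, so it is transferred to \<open>A\<close> instead of being derived from the MV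
    axioms.\<close>
  have dist_self: "mv_eval A v (mv_dist_term p q) = mv_zero A"
    if "mv_eval A v p = mv_eval A v q" for p q
  proof -
    have x: "mv_eval A v p \<in> carrier A"
      using mv_eval_closed[of A v p] mv_n1_algebra_closed[OF A] v by simp
    have "mv_eval A (\<lambda>_. mv_eval A v p) (mv_dist_term (MVar 0) (MVar 0))
      = mv_eval A (\<lambda>_. mv_eval A v p) MZero"
      by (rule mv_n1_algebra_identity[of n A "\<lambda>_. mv_eval A v p", OF A x]) (simp add: chain_dist_term_eq_0_iff)
    with that show ?thesis by (simp add: mv_dist_term_def)
  qed
  have "mv_eval A v (d p) = mv_zero A" if "p \<in> S" for p
  proof -
    obtain x y where p: "p = (x, y)" by force
    have "{x, y, mv_plus A x y, mv_neg A x, mv_zero A} \<subseteq> F"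
      using that p by (auto simp: F_def)
    then show ?thesis
      using dist_self[of "MPlus (V x) (V y)" "V (mv_plus A x y)"]
        dist_self[of "MNeg (V x)" "V (mv_neg A x)"] dist_self[of MZero "V (mv_zero A)"]
      by (simp add: p d_def V_def v_idx zz)
  qed
  then have "set ys \<subseteq> S \<Longrightarrow> mv_eval A v (foldr MPlus (map d ys) MZero) = mv_zero A" for ys
    by (induction ys) (auto simp: zz)
  then have "mv_eval A v N = mv_zero A"
    unfolding N_def mv_eval_multiple E_def using xs by (simp add: multiple_zero)
  then have t: "mv_eval A v (t x) = x" if "x \<in> F" for x
    using that subsetD[OF F(2) that]
    by (simp add: t_def V_def v_idx mv_n1_algebra_plus_zero[OF A] mv_n1_algebra_neg_neg[OF A] cl)
  have "mv_eval A v (t a) \<noteq> mv_eval A v (t b)"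
    using ab by (simp add: t F_def)
  then obtain w where w: "\<And>i. w i \<in> carrier L" and ne: "mv_eval L w (t a) \<noteq> mv_eval L w (t b)"
    using mv_n1_algebra_identity[of n A v "t a" "t b", OF A v] by metis
  note ev = mv_eval_closed[where v = w, OF chain_closed w]
  have "mv_eval L w E = 0"
  proof (rule ccontr)
    assume "mv_eval L w E \<noteq> 0"
    then have "mv_eval L w N = 1"
      unfolding N_def mv_eval_multiple using chain_multiple_n[OF ev] by simp
    then show False using ne chain_bounds[OF w] by (simp add: t_def V_def)
  qed
  then have d0: "mv_eval L w (d p) = 0" if "p \<in> S" for p
    using chain_foldr_plus_eq_0[of w "map d xs" "d p", OF w] that xs by (simp add: E_def)
  define h where "h = (\<lambda>x\<in>carrier A. w (idx x))"
  have "h \<in> carrier A \<rightarrow>\<^sub>E carrier L" by (simp add: h_def w)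
  moreover have "h a \<noteq> h b" using ne ab by (auto simp: h_def t_def V_def)
  moreover have "h (mv_plus A x y) = min 1 (h x + h y)" "h (mv_neg A x) = 1 - h x" "h (mv_zero A) = 0"
    if "(x, y) \<in> S" for x y
  proof -
    let ?e1 = "mv_dist_term (MPlus (V x) (V y)) (V (mv_plus A x y))"
    let ?e2 = "mv_dist_term (MNeg (V x)) (V (mv_neg A x))"
    let ?e3 = "mv_dist_term MZero (V (mv_zero A))"
    have "mv_eval L w (MPlus ?e1 (MPlus ?e2 ?e3)) = 0" using d0[OF that] by (simp add: d_def)
    then have "mv_eval L w ?e1 = 0 \<and> mv_eval L w ?e2 = 0 \<and> mv_eval L w ?e3 = 0"
      using chain_eval_bounds(1)[of w ?e1, OF w] chain_eval_bounds(1)[of w ?e2, OF w]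
        chain_eval_bounds(1)[of w ?e3, OF w] by (simp add: min_def split: if_splits)
    then have "w (idx (mv_plus A x y)) = min 1 (w (idx x) + w (idx y))"
      "w (idx (mv_neg A x)) = 1 - w (idx x)" "w (idx (mv_zero A)) = 0"
      by (simp_all add: chain_dist_term_eq_0_iff w V_def)
    then show "h (mv_plus A x y) = min 1 (h x + h y)" "h (mv_neg A x) = 1 - h x" "h (mv_zero A) = 0"
      using that S(2) by (auto simp: h_def cl)
  qed
  ultimately show ?thesis by blast
qed

section \<open>The compact power of the chain and separation of points\<close>

abbreviation chain_power :: "'c mv_struct \<Rightarrow> ('c \<Rightarrow> real) topology" where
  "chain_power A \<equiv> product_topology (\<lambda>_. discrete_topology (carrier L)) (carrier A)"

text \<open>The discrete version yields open fibres; the real-valued one makes equations between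
  values closed by continuity of real arithmetic.\<close>

lemma continuous_map_chain_power_eval:
  assumes "x \<in> carrier A"
  shows "continuous_map (chain_power A) (discrete_topology (carrier L)) (\<lambda>h. h x)"
    and "continuous_map (chain_power A) euclideanreal (\<lambda>h. h x)"
proof -
  show *: "continuous_map (chain_power A) (discrete_topology (carrier L)) (\<lambda>h. h x)"
    using continuous_map_product_projection[OF assms, of "\<lambda>_. discrete_topology (carrier L)"] by simp
  have "continuous_map (discrete_topology (carrier L)) euclideanreal id" by simp
  from continuous_map_compose[OF * this]
  show "continuous_map (chain_power A) euclideanreal (\<lambda>h. h x)" by (simp add: o_def)
qed

text \<open>The condition at zero is attached to every pair, so that the set of homomorphisms is a
  single intersection over pairs; the carrier contains zero, hence there is at least one
  pair.\<close>

definition mv_hom_at :: "'c mv_struct \<Rightarrow> 'c \<Rightarrow> 'c \<Rightarrow> ('c \<Rightarrow> real) set" where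
  "mv_hom_at A x y = {h \<in> carrier A \<rightarrow>\<^sub>E carrier L. h (mv_plus A x y) = min 1 (h x + h y) \<and>
     h (mv_neg A x) = 1 - h x \<and> h (mv_zero A) = 0}"

lemma topspace_chain_power: "topspace (chain_power A) = carrier A \<rightarrow>\<^sub>E carrier L"
  by simp

lemma mv_hom_at_closedin:
  assumes A: "mv_closed A" and xy: "x \<in> carrier A" "y \<in> carrier A"
  shows "closedin (chain_power A) (mv_hom_at A x y)"
proof -
  let ?X = "chain_power A"
  note ev = continuous_map_chain_power_eval(2)
  note cl = mv_closedD[OF A]
  have one: "continuous_map ?X euclideanreal (\<lambda>_. 1)" and zero: "continuous_map ?X euclideanreal (\<lambda>_. 0)"
    by simp_all
  note eqI = closedin_continuous_maps_eq[OF Hausdorff_space_euclidean]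
  have 1: "closedin ?X {h \<in> topspace ?X. h (mv_plus A x y) = min 1 (h x + h y)}"
    by (rule eqI[OF ev[OF cl(3)[OF xy]]
      continuous_map_real_min[OF one continuous_map_add[OF ev[OF xy(1)] ev[OF xy(2)]]]])
  have 2: "closedin ?X {h \<in> topspace ?X. h (mv_neg A x) = 1 - h x}"
    by (rule eqI[OF ev[OF cl(2)[OF xy(1)]] continuous_map_diff[OF one ev[OF xy(1)]]])
  have 3: "closedin ?X {h \<in> topspace ?X. h (mv_zero A) = 0}"
    by (rule eqI[OF ev[OF cl(1)] zero])
  have eq: "mv_hom_at A x y = {h \<in> topspace ?X. h (mv_plus A x y) = min 1 (h x + h y)} \<inter>
      {h \<in> topspace ?X. h (mv_neg A x) = 1 - h x} \<inter> {h \<in> topspace ?X. h (mv_zero A) = 0}"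
    unfolding mv_hom_at_def topspace_chain_power by blast
  show ?thesis unfolding eq by (intro closedin_Int 1 2 3)
qed

lemma compact_chain_power: "compact_space (chain_power A)"
  by (simp add: compact_space_product_topology compact_space_discrete_topology finite_chain)

lemma mv_hom_eq_INT:
  assumes A: "mv_closed A"
  shows "mv_hom A L = (\<Inter>(x, y)\<in>carrier A \<times> carrier A. mv_hom_at A x y)"
  using mv_closedD(1)[OF A] by (auto simp: mv_hom_def mv_hom_at_def)

lemma mv_hom_closedin:
  assumes A: "mv_closed A"
  shows "closedin (chain_power A) (mv_hom A L)"
  unfolding mv_hom_eq_INT[OF A] using mv_closedD(1)[OF A]
  by (intro closedin_INT) (auto intro!: mv_hom_at_closedin A)

lemma mv_hom_separating:
  assumes A: "mv_n1_algebra n A" and ab: "a \<in> carrier A" "b \<in> carrier A" "a \<noteq> b"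
  shows "\<exists>h\<in>mv_hom A L. h a \<noteq> h b"
proof -
  let ?X = "chain_power A"
  note cA = mv_n1_algebra_closed[OF A]
  \<comment> \<open>By the gap \<open>1/n\<close> in the chain, \<open>h a \<noteq> h b\<close> is
    the same as this closed condition, as the compactness argument requires.\<close>
  define Z where "Z = {h \<in> topspace ?X. real n * \<bar>h a - h b\<bar> \<in> {1..}}"
  define K where "K = (\<lambda>(x, y). mv_hom_at A x y \<inter> Z)"
  have "closedin ?X Z"
    unfolding Z_def
    by (rule closedin_continuous_map_preimage[OF continuous_map_real_mult[OF _ continuous_map_real_abs[OF
        continuous_map_diff[OF continuous_map_chain_power_eval(2)[OF ab(1)] continuous_map_chain_power_eval(2)[OF ab(2)]]]]]) simp_all
  then have closed: "closedin ?X (K p)" if "p \<in> carrier A \<times> carrier A" for p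
    using that unfolding K_def by (auto split: prod.split intro!: closedin_Int mv_hom_at_closedin cA)
  have fin: "(\<Inter>p\<in>S. K p) \<noteq> {}" if S: "finite S" "S \<subseteq> carrier A \<times> carrier A" for S
  proof -
    obtain h where h: "h \<in> carrier A \<rightarrow>\<^sub>E carrier L" "h a \<noteq> h b" "\<forall>(x, y)\<in>S.
        h (mv_plus A x y) = min 1 (h x + h y) \<and> h (mv_neg A x) = 1 - h x \<and> h (mv_zero A) = 0"
      using finite_partial_hom[OF A ab S] by blast
    have "h a \<in> carrier L" "h b \<in> carrier L" using h(1) ab by auto
    then have "1 \<le> real n * \<bar>h a - h b\<bar>"
      using h(2) chain_gap[of "h a" "h b"] chain_gap[of "h b" "h a"] by (auto simp: abs_if)
    then have "h \<in> Z" using h(1) by (simp add: Z_def)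
    with h have "h \<in> (\<Inter>p\<in>S. K p)" by (auto simp: K_def mv_hom_at_def)
    then show ?thesis by blast
  qed
  have "(\<Inter>p\<in>carrier A \<times> carrier A. K p) \<noteq> {}"
  \<comment> \<open>A finite subfamily involves only finitely many pairs, and for these a partial
    homomorphism separating \<open>a\<close> and \<open>b\<close> exists.\<close>
  proof (rule compact_space_fip[THEN iffD1, OF compact_chain_power[of A], rule_format])
    show "(\<forall>C\<in>K ` (carrier A \<times> carrier A). closedin ?X C) \<and>
      (\<forall>\<F>. finite \<F> \<and> \<F> \<subseteq> K ` (carrier A \<times> carrier A) \<longrightarrow> \<Inter>\<F> \<noteq> {})"
    proof (intro conjI allI impI)
      fix \<F> assume "finite \<F> \<and> \<F> \<subseteq> K ` (carrier A \<times> carrier A)"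
      then obtain S where "finite S" "S \<subseteq> carrier A \<times> carrier A" "\<F> = K ` S"
        by (meson finite_subset_image)
      with fin show "\<Inter>\<F> \<noteq> {}" by simp
    qed (use closed in blast)
  qed
  then obtain h where h: "h \<in> K (x, y)" if "x \<in> carrier A" "y \<in> carrier A" for x y by auto
  have "h \<in> mv_hom A L" unfolding mv_hom_eq_INT[OF cA] using h by (auto simp: K_def)
  moreover have "h a \<noteq> h b" using h[OF ab(1,2)] by (auto simp: K_def Z_def)
  ultimately show ?thesis by blast
qed

section \<open>Two-valued elements\<close>

lemma hom_multiple:
  assumes "mv_closed A" "a \<in> carrier A" "h \<in> mv_hom A L"
  shows "h (mv_multiple A k a) = min 1 (real k * h a)"
proof -
  have "h (mv_multiple A k a) = mv_multiple L k (h a)"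
    unfolding mv_multiple_def
    using assms mv_multiple_closed[OF assms(1,2)] 
    by (induction k) (simp_all add: mv_hom_chainD mv_multiple_def)
  then show ?thesis using chain_multiple mv_hom_chainD(2)[OF assms(3,2)] chain_bounds by simp
qed

lemma hom_odot:
  assumes "mv_closed A" "a \<in> carrier A" "b \<in> carrier A" "h \<in> mv_hom A L"
  shows "h (mv_odot A a b) = max 0 (h a + h b - 1)"
  using assms by (simp add: mv_odot_def mv_hom_chainD[OF assms(4)] mv_closedD)

definition two_valued :: "'c mv_struct \<Rightarrow> 'c set" where
  "two_valued A = {b \<in> carrier A. \<forall>h\<in>mv_hom A L. h b = 0 \<or> h b = 1}"

text \<open>
  Doubling \<open>a \<oplus> a\<close> and squaring \<open>a \<odot> a\<close> double the distance of two values of \<open>a\<close> that lie in the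
  same half of the unit interval.
\<close>

lemma two_valued_separator:
  assumes A: "mv_closed A" and h: "h \<in> mv_hom A L" and g: "g \<in> mv_hom A L"
    and a: "a \<in> carrier A" "h a < g a"
  shows "\<exists>b\<in>two_valued A. h b = 0 \<and> g b = 1"
proof -
  have top: "\<exists>b\<in>two_valued A. h b = 0 \<and> g b = 1"
    if a: "a \<in> carrier A" "h a < 1" "g a = 1" for a
  proof -
    \<comment> \<open>Under every homomorphism the \<open>n\<close>-fold sum of the negation of
      \<open>a\<close> is 0 if \<open>a\<close> has value 1, and is 1 otherwise. Its negation is
      therefore the indicator of "\<open>a\<close> has value 1".\<close>
    let ?b = "mv_neg A (mv_multiple A n (mv_neg A a))"
    have *: "k ?b = (if k a = 1 then 1 else 0)" if k: "k \<in> mv_hom A L" for k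
    proof -
      have na: "mv_neg A a \<in> carrier A" by (rule mv_closedD(2)[OF A a(1)])
      have "k (mv_neg A a) = 1 - k a" by (rule mv_hom_chainD(3)[OF k a(1)])
      then have *: "k ?b = 1 - min 1 (real n * (1 - k a))"
        using mv_hom_chainD(3)[OF k mv_multiple_closed[OF A na]] hom_multiple[OF A na k] by simp
      have "k a \<in> carrier L" by (rule mv_hom_chainD(2)[OF k a(1)])
      then have "k a \<le> 1" "k a < 1 \<Longrightarrow> 1 \<le> real n * (1 - k a)"
        using chain_gap[OF _ chain_one] chain_bounds by auto
      then show ?thesis unfolding * by (cases "k a = 1") auto
    qed
    have "?b \<in> carrier A" by (intro mv_closedD mv_multiple_closed A a)
    then have "?b \<in> two_valued A" using * unfolding two_valued_def by fastforce
    moreover have "h ?b = 0 \<and> g ?b = 1" using *[OF h] *[OF g] a by simp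
    ultimately show ?thesis by blast
  qed
  \<comment> \<open>Induction on the number of doublings that remain: a gap of at least 1 forces the
    values 0 and 1, where \<open>top\<close> applies.\<close>
  have step: "\<exists>b\<in>two_valued A. h b = 0 \<and> g b = 1"
    if "a \<in> carrier A" "1 / 2 ^ m \<le> g a - h a" for m a
    using that
  proof (induction m arbitrary: a)
    case 0
    then show ?case
      using chain_bounds[OF mv_hom_chainD(2)[OF h 0(1)]] chain_bounds[OF mv_hom_chainD(2)[OF g 0(1)]]
      by (intro top[of a]) simp_all
  next
    case (Suc m)
    let ?d = "mv_plus A a a" and ?s = "mv_odot A a a"
    have ds: "?d \<in> carrier A" "?s \<in> carrier A"
      by (intro mv_closedD mv_odot_closed A Suc.prems)+
    have hd: "h ?d = min 1 (h a + h a)" "g ?d = min 1 (g a + g a)"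
      "h ?s = max 0 (h a + h a - 1)" "g ?s = max 0 (g a + g a - 1)"
      by (rule mv_hom_chainD(4)[OF h Suc.prems(1) Suc.prems(1)] mv_hom_chainD(4)[OF g Suc.prems(1) Suc.prems(1)]
        hom_odot[OF A Suc.prems(1) Suc.prems(1) h] hom_odot[OF A Suc.prems(1) Suc.prems(1) g])+
    have "0 < 1 / (2 :: real) ^ Suc m" "1 / (2 :: real) ^ m = 2 * (1 / 2 ^ Suc m)" by simp_all
    with Suc.prems(2) have gap: "1 / 2 ^ m \<le> 2 * (g a - h a)" and "0 < g a - h a"
      by (metis mult_left_mono zero_le_numeral) (use Suc.prems(2) \<open>0 < _\<close> in \<open>rule less_le_trans[rotated]\<close>)
    \<comment> \<open>If both values lie in the upper half, \<open>?s\<close> doubles the gap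
      without truncation; in the lower half \<open>?d\<close> does. If they straddle
      \<open>1/2\<close>, then \<open>?d\<close> already has value 1 at \<open>g\<close> and a
      smaller value at \<open>h\<close>.\<close>
    consider "h a \<ge> 1/2" | "h a < 1/2" "g a \<ge> 1/2" | "g a < 1/2" by linarith
    then show ?case
    proof cases
      case 1
      with gap show ?thesis by (intro Suc.IH[OF ds(2)]) (simp add: hd)
    next
      case 2
      then show ?thesis by (intro top[OF ds(1)]) (simp_all add: hd)
    next
      case 3
      with gap show ?thesis by (intro Suc.IH[OF ds(1)]) (simp add: hd)
    qed
  qed
  obtain m where "(1 / 2) ^ m < g a - h a"
    using real_arch_pow_inv[of "g a - h a" "1/2"] a(2) by auto
  then show ?thesis using step[OF a(1), of m] by (simp add: power_one_over)
qed

text \<open>Negation reverses the order of two values, so of \<open>a\<close> and its negation one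
  is smaller at \<open>h\<close> than at \<open>g\<close>.\<close>

lemma two_valued_separator_neq:
  assumes A: "mv_closed A" and h: "h \<in> mv_hom A L" and g: "g \<in> mv_hom A L" and ne: "h \<noteq> g"
  shows "\<exists>b\<in>two_valued A. h b = 0 \<and> g b = 1"
proof -
  obtain a where a: "a \<in> carrier A" "h a \<noteq> g a" using ne mv_hom_eqI[OF h g] by blast
  then consider "h a < g a" | "h (mv_neg A a) < g (mv_neg A a)"
    using mv_hom_chainD(3)[OF h a(1)] mv_hom_chainD(3)[OF g a(1)] by fastforce
  then show ?thesis
    using two_valued_separator[OF A h g] a mv_closedD(2)[OF A] by cases blast+
qed

end

section \<open>Boolean spaces\<close>

lemma finite_Union_closed:
  assumes "{} \<in> \<B>" "\<And>B C. B \<in> \<B> \<Longrightarrow> C \<in> \<B> \<Longrightarrow> B \<union> C \<in> \<B>" "finite \<F>" "\<F> \<subseteq> \<B>"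
  shows "\<Union>\<F> \<in> \<B>"
  using assms(3,4) by (induction \<F>) (auto intro: assms(1,2))

text \<open>The base condition in local form, which is the form that compactness arguments produce
  and consume.\<close>

lemma boolean_space_alt:
  "boolean_space X \<longleftrightarrow> compact_space X \<and> Hausdorff_space X \<and>
     (\<forall>U x. openin X U \<and> x \<in> U \<longrightarrow> (\<exists>C\<in>clopens X. x \<in> C \<and> C \<subseteq> U))"
proof -
  have *: "(arbitrary union_of (\<lambda>C. C \<in> clopens X)) U \<longleftrightarrow> (\<forall>x\<in>U. \<exists>C\<in>clopens X. x \<in> C \<and> C \<subseteq> U)" for U
  proof
    assume "(arbitrary union_of (\<lambda>C. C \<in> clopens X)) U"
    then obtain \<F> where "\<F> \<subseteq> clopens X" "\<Union>\<F> = U"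
      unfolding union_of_def arbitrary_def by auto
    then show "\<forall>x\<in>U. \<exists>C\<in>clopens X. x \<in> C \<and> C \<subseteq> U" by blast
  next
    assume "\<forall>x\<in>U. \<exists>C\<in>clopens X. x \<in> C \<and> C \<subseteq> U"
    then have "\<Union>{C \<in> clopens X. C \<subseteq> U} = U" by (intro equalityI subsetI) blast+
    then show "(arbitrary union_of (\<lambda>C. C \<in> clopens X)) U"
      unfolding union_of_def arbitrary_def by (intro exI[of _ "{C \<in> clopens X. C \<subseteq> U}"]) auto
  qed
  have "openin X U" if "\<forall>x\<in>U. \<exists>C\<in>clopens X. x \<in> C \<and> C \<subseteq> U" for U
    using that by (subst openin_subopen) blast
  then show ?thesis unfolding boolean_space_def * by metis
qed

text \<open>This abstracts the situation in the space of homomorphisms, where the members of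
  \<open>\<B>\<close> are the sets on which a two-valued element is 1. Separation and compactness
  make \<open>\<B>\<close> a base, yield the Hausdorff property, and leave no clopen set outside
  \<open>\<B>\<close>.\<close>

locale separating_clopen_algebra =
  fixes X :: "'p topology" and \<B> :: "'p set set"
  assumes compact: "compact_space X"
    and clopen: "B \<in> \<B> \<Longrightarrow> openin X B"
    and empty: "{} \<in> \<B>"
    and compl: "B \<in> \<B> \<Longrightarrow> topspace X - B \<in> \<B>"
    and Un: "B \<in> \<B> \<Longrightarrow> C \<in> \<B> \<Longrightarrow> B \<union> C \<in> \<B>"
    and separating: "x \<in> topspace X \<Longrightarrow> y \<in> topspace X \<Longrightarrow> x \<noteq> y \<Longrightarrow> \<exists>B\<in>\<B>. x \<in> B \<and> y \<notin> B"
begin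

lemma closed: "B \<in> \<B> \<Longrightarrow> closedin X B"
  using clopen[OF compl] clopen openin_subset by (fastforce simp: closedin_def)

text \<open>The members of \<open>\<B>\<close> omitting \<open>x\<close> cover the compact
  complement of \<open>U\<close>; the complement of the union of a finite subcover is the required
  neighbourhood.\<close>

lemma neighbourhood:
  assumes U: "openin X U" and x: "x \<in> U"
  shows "\<exists>B\<in>\<B>. x \<in> B \<and> B \<subseteq> U"
proof -
  have xX: "x \<in> topspace X" using U x openin_subset by blast
  have "compactin X (topspace X - U)" by (intro closedin_compact_space compact) (use U in blast)
  moreover have "\<forall>B\<in>{B \<in> \<B>. x \<notin> B}. openin X B" using clopen by blast
  moreover have "topspace X - U \<subseteq> \<Union>{B \<in> \<B>. x \<notin> B}"
    using separating[OF _ xX] x by fastforce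
  ultimately obtain \<F> where \<F>: "finite \<F>" "\<F> \<subseteq> {B \<in> \<B>. x \<notin> B}" "topspace X - U \<subseteq> \<Union>\<F>"
    unfolding compactin_def by meson
  have "\<Union>\<F> \<in> \<B>" using \<F> by (intro finite_Union_closed empty Un) auto
  then have "topspace X - \<Union>\<F> \<in> \<B>" by (rule compl)
  moreover have "x \<in> topspace X - \<Union>\<F>" "topspace X - \<Union>\<F> \<subseteq> U" using \<F> xX by auto
  ultimately show ?thesis by blast
qed

text \<open>Passage from local to global for a property inherited by subsets. It is used with
  "contained in a given clopen set" to find all clopen sets, and with "some element represents the
  function here" for patching.\<close>

lemma finite_subcover:
  assumes C: "closedin X C" and P: "\<And>x. x \<in> C \<Longrightarrow> \<exists>U. openin X U \<and> x \<in> U \<and> P U"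
    and mono: "\<And>U V. P U \<Longrightarrow> V \<subseteq> U \<Longrightarrow> P V"
  obtains \<F> where "finite \<F>" "\<F> \<subseteq> \<B>" "\<And>B. B \<in> \<F> \<Longrightarrow> P B" "C \<subseteq> \<Union>\<F>"
proof -
  have "C \<subseteq> \<Union>{B \<in> \<B>. P B}"
  proof
    fix x assume "x \<in> C"
    then obtain U where "openin X U" "x \<in> U" "P U" using P by blast
    then show "x \<in> \<Union>{B \<in> \<B>. P B}" using neighbourhood mono by blast
  qed
  moreover have "compactin X C" by (rule closedin_compact_space[OF compact C])
  moreover have "\<forall>B\<in>{B \<in> \<B>. P B}. openin X B" using clopen by blast
  ultimately obtain \<F> where "finite \<F>" "\<F> \<subseteq> {B \<in> \<B>. P B}" "C \<subseteq> \<Union>\<F>"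
    unfolding compactin_def by meson
  then show thesis by (intro that[of \<F>]) auto
qed

lemma clopens_eq: "clopens X = \<B>"
proof
  show "\<B> \<subseteq> clopens X" using clopen closed by blast
  show "clopens X \<subseteq> \<B>"
  proof
    fix C assume C: "C \<in> clopens X"
    then obtain \<F> where \<F>: "finite \<F>" "\<F> \<subseteq> \<B>" "\<And>B. B \<in> \<F> \<Longrightarrow> B \<subseteq> C" "C \<subseteq> \<Union>\<F>"
      using finite_subcover[of C "\<lambda>B. B \<subseteq> C"] by blast
    have "\<Union>\<F> \<in> \<B>" using \<F> by (intro finite_Union_closed empty Un) auto
    moreover have "C = \<Union>\<F>" using \<F> by blast
    ultimately show "C \<in> \<B>" by simp
  qed
qed

lemma boolean: "boolean_space X"
proof -
  have "Hausdorff_space X"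
    unfolding Hausdorff_space_def
  proof (intro allI impI)
    fix x y assume xy: "x \<in> topspace X \<and> y \<in> topspace X \<and> x \<noteq> y"
    then obtain B where B: "B \<in> \<B>" "x \<in> B" "y \<notin> B" using separating by blast
    then show "\<exists>U V. openin X U \<and> openin X V \<and> x \<in> U \<and> y \<in> V \<and> disjnt U V"
      using clopen compl xy
      by (intro exI[of _ B] exI[of _ "topspace X - B"]) (auto simp: disjnt_def)
  qed
  then show ?thesis
    unfolding boolean_space_alt clopens_eq using compact neighbourhood by blast
qed

end

lemma homeomorphic_map_clopens:
  assumes f: "homeomorphic_map X Y f"
  shows "clopens Y = (`) f ` clopens X"
proof -
  have img: "f ` topspace X = topspace Y" by (rule homeomorphic_imp_surjective_map[OF f])
  note cont = homeomorphic_imp_continuous_map[OF f]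
  have "C \<in> (`) f ` clopens X" if C: "openin Y C" "closedin Y C" for C
  proof (rule image_eqI)
    show "C = f ` {x \<in> topspace X. f x \<in> C}"
      using openin_subset[OF C(1)] unfolding img[symmetric] by blast
    show "{x \<in> topspace X. f x \<in> C} \<in> clopens X"
      by (simp add: openin_continuous_map_preimage[OF cont C(1)] closedin_continuous_map_preimage[OF cont C(2)])
  qed
  moreover have "openin Y (f ` C)" "closedin Y (f ` C)" if "openin X C" "closedin X C" for C
    using that homeomorphic_map_openness_eq[OF f, of C] homeomorphic_map_closedness_eq[OF f, of C] by simp_all
  ultimately show ?thesis by (intro equalityI subsetI) auto
qed

lemma homeomorphic_boolean_space:
  assumes f: "homeomorphic_map X Y f" and X: "boolean_space X"
  shows "boolean_space Y"
proof -
  have hs: "X homeomorphic_space Y" by (rule homeomorphic_map_imp_homeomorphic_space[OF f])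
  have "\<exists>C\<in>clopens Y. y \<in> C \<and> C \<subseteq> U" if U: "openin Y U" and y: "y \<in> U" for U y
  proof -
    obtain x where x: "x \<in> topspace X" "y = f x"
      using openin_subset[OF U] y homeomorphic_imp_surjective_map[OF f] by fastforce
    have "openin X {x \<in> topspace X. f x \<in> U}"
      using homeomorphic_imp_continuous_map[OF f] U by (rule openin_continuous_map_preimage)
    then obtain C where "C \<in> clopens X" "x \<in> C" "C \<subseteq> {x \<in> topspace X. f x \<in> U}"
      using X x y unfolding boolean_space_alt by blast
    then show ?thesis
      unfolding homeomorphic_map_clopens[OF f] using x by (intro bexI[of _ "f ` C"]) auto
  qed
  then show ?thesis
    using X homeomorphic_compact_space[OF hs] homeomorphic_Hausdorff_space[OF hs]
    unfolding boolean_space_alt by blast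
qed

section \<open>The space of homomorphisms into the chain\<close>

context chain_order
begin

lemma chain_cases:
  assumes "x \<in> carrier L"
  obtains "x = 0" | "x = 1" | i where "i \<in> {1..n - 1}" "x = real i / real n"
proof -
  obtain k where k: "k \<le> n" "x = real k / real n" using assms by (auto simp: chain_carrier)
  consider "k = 0" | "k = n" | "k \<in> {1..n - 1}" using k(1) by fastforce
  then show thesis
    by cases (use that k n_pos in auto)
qed

definition hom_space :: "'c mv_struct \<Rightarrow> ('c \<Rightarrow> real) topology" where
  "hom_space A = subtopology (chain_power A) (mv_hom A L)"

definition truth_set :: "'c mv_struct \<Rightarrow> 'c \<Rightarrow> ('c \<Rightarrow> real) set" where
  "truth_set A b = {h \<in> mv_hom A L. h b = 1}"

lemma two_valuedI:
  assumes "b \<in> carrier A" and b: "\<forall>h\<in>mv_hom A L. h b = (if P h then 1 else 0)"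
  shows "b \<in> two_valued A" "truth_set A b = {h \<in> mv_hom A L. P h}"
proof -
  have "h b = 0 \<or> h b = 1" "h b = 1 \<longleftrightarrow> P h" if "h \<in> mv_hom A L" for h
    using bspec[OF b that] by auto
  then show "b \<in> two_valued A" "truth_set A b = {h \<in> mv_hom A L. P h}"
    unfolding two_valued_def truth_set_def using assms(1) by blast+
qed

lemma topspace_hom_space: "topspace (hom_space A) = mv_hom A L"
  by (auto simp: hom_space_def mv_hom_def)

lemma compact_hom_space: "mv_closed A \<Longrightarrow> compact_space (hom_space A)"
  unfolding hom_space_def
  by (intro compact_space_subtopology closedin_compact_space compact_chain_power mv_hom_closedin)

lemma continuous_map_hom_space_eval:
  "a \<in> carrier A \<Longrightarrow> continuous_map (hom_space A) (discrete_topology (carrier L)) (\<lambda>h. h a)"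
  unfolding hom_space_def by (intro continuous_map_from_subtopology continuous_map_chain_power_eval)

lemma continuous_map_into_hom_space:
  assumes "\<And>x. x \<in> topspace X \<Longrightarrow> F x \<in> mv_hom A L"
    and "\<And>a. a \<in> carrier A \<Longrightarrow> continuous_map X (discrete_topology (carrier L)) (\<lambda>x. F x a)"
  shows "continuous_map X (hom_space A) F"
proof -
  have "continuous_map X (chain_power A) F"
    by (rule continuous_map_coordinatewise_then_product) (auto simp: assms(2) extensional_arb[OF mv_homD(5)[OF assms(1)]])
  then show ?thesis
    using assms(1) by (auto simp: hom_space_def continuous_map_in_subtopology)
qed

lemma openin_hom_space_fibre:
  assumes "a \<in> carrier A"
  shows "openin (hom_space A) {h \<in> mv_hom A L. h a = c}"
proof -
  have "openin (discrete_topology (carrier L)) ({c} \<inter> carrier L)" by simp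
  from openin_continuous_map_preimage[OF continuous_map_hom_space_eval[OF assms] this]
  have "openin (hom_space A) {h \<in> mv_hom A L. h a \<in> {c} \<inter> carrier L}"
    by (simp only: topspace_hom_space)
  moreover have "{h \<in> mv_hom A L. h a \<in> {c} \<inter> carrier L} = {h \<in> mv_hom A L. h a = c}"
    using assms by (auto dest: mv_homD(2))
  ultimately show ?thesis by simp
qed

text \<open>On two-valued elements the operations are Boolean: negation gives complements and
  addition gives unions of truth sets. Separation is the existence of two-valued separators.\<close>

lemma hom_space_separating_clopen_algebra:
  assumes A: "mv_closed A"
  shows "separating_clopen_algebra (hom_space A) (truth_set A ` two_valued A)"
proof
  show "compact_space (hom_space A)" by (rule compact_hom_space[OF A])
next
  fix B assume "B \<in> truth_set A ` two_valued A"
  then show "openin (hom_space A) B"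
    by (auto simp: truth_set_def two_valued_def openin_hom_space_fibre)
next
  have "mv_zero A \<in> two_valued A" "truth_set A (mv_zero A) = {h \<in> mv_hom A L. False}"
    using two_valuedI[of "mv_zero A" A "\<lambda>_. False"] mv_closedD(1)[OF A] mv_hom_chainD(1)[of _ A n] by simp_all
  then show "{} \<in> truth_set A ` two_valued A" by auto
next
  fix B assume "B \<in> truth_set A ` two_valued A"
  then obtain b where b: "b \<in> two_valued A" "B = truth_set A b" by blast
  then have bA: "b \<in> carrier A" by (simp add: two_valued_def)
  have "\<forall>h\<in>mv_hom A L. h (mv_neg A b) = (if h b \<noteq> 1 then 1 else 0)"
  proof
    fix h assume "h \<in> mv_hom A L"
    with b(1) show "h (mv_neg A b) = (if h b \<noteq> 1 then 1 else 0)"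
      using mv_hom_chainD(3)[of h A n b] bA by (auto simp: two_valued_def)
  qed
  note * = two_valuedI[OF mv_closedD(2)[OF A bA] this]
  have "topspace (hom_space A) - B = truth_set A (mv_neg A b)"
    unfolding *(2) b(2) topspace_hom_space unfolding truth_set_def by blast
  with *(1) show "topspace (hom_space A) - B \<in> truth_set A ` two_valued A" by blast
next
  fix B C assume "B \<in> truth_set A ` two_valued A" "C \<in> truth_set A ` two_valued A"
  then obtain b c where b: "b \<in> two_valued A" "B = truth_set A b"
    and c: "c \<in> two_valued A" "C = truth_set A c" by blast
  then have bc: "b \<in> carrier A" "c \<in> carrier A" by (simp_all add: two_valued_def)
  have "\<forall>h\<in>mv_hom A L. h (mv_plus A b c) = (if h b = 1 \<or> h c = 1 then 1 else 0)"
  proof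
    fix h assume h: "h \<in> mv_hom A L"
    then have "h b = 0 \<or> h b = 1" "h c = 0 \<or> h c = 1"
      using b(1) c(1) unfolding two_valued_def by blast+
    with h show "h (mv_plus A b c) = (if h b = 1 \<or> h c = 1 then 1 else 0)"
      using mv_hom_chainD(4)[of h A n b c] bc by auto
  qed
  note * = two_valuedI[OF mv_closedD(3)[OF A bc] this]
  have "B \<union> C = truth_set A (mv_plus A b c)"
    unfolding *(2) b(2) c(2) unfolding truth_set_def by blast
  with *(1) show "B \<union> C \<in> truth_set A ` two_valued A" by blast
next
  fix h g assume "h \<in> topspace (hom_space A)" "g \<in> topspace (hom_space A)" "h \<noteq> g"
  then obtain b where "b \<in> two_valued A" "g b = 0" "h b = 1"
    using two_valued_separator_neq[OF A, of g h] by (auto simp: topspace_hom_space)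
  then show "\<exists>B\<in>truth_set A ` two_valued A. h \<in> B \<and> g \<notin> B"
    using \<open>h \<in> topspace (hom_space A)\<close> by (auto simp: truth_set_def topspace_hom_space)
qed

text \<open>Both \<open>f\<close> and the evaluation at an element of \<open>A\<close> are locally
  constant, so agreement at one homomorphism extends to a neighbourhood. Finitely many such
  neighbourhoods are truth sets, over which the representing elements can be glued.\<close>

lemma hom_space_representable:
  assumes A: "mv_closed A"
    and cont: "\<And>c. openin (hom_space A) {h \<in> mv_hom A L. f h = c}"
    and val: "\<And>h. h \<in> mv_hom A L \<Longrightarrow> \<exists>a\<in>carrier A. h a = f h"
  shows "\<exists>a\<in>carrier A. \<forall>h\<in>mv_hom A L. h a = f h"
proof -
  interpret separating_clopen_algebra "hom_space A" "truth_set A ` two_valued A"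
    by (rule hom_space_separating_clopen_algebra[OF A])
  define P where "P U \<longleftrightarrow> (\<exists>a\<in>carrier A. \<forall>h\<in>U. h a = f h)" for U
  have local: "\<exists>U. openin (hom_space A) U \<and> h \<in> U \<and> P U" if h: "h \<in> mv_hom A L" for h
  proof -
    obtain a where a: "a \<in> carrier A" "h a = f h" using val[OF h] by blast
    let ?U = "{k \<in> mv_hom A L. k a = h a} \<inter> {k \<in> mv_hom A L. f k = f h}"
    have "openin (hom_space A) ?U"
      by (intro openin_Int openin_hom_space_fibre cont a(1))
    moreover have "h \<in> ?U" using h by simp
    moreover have "P ?U" unfolding P_def using a by (intro bexI[of _ a]) simp_all
    ultimately show ?thesis by blast
  qed
  have mono: "P V" if "P U" "V \<subseteq> U" for U V
    using that unfolding P_def by (meson subsetD)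
  obtain \<F> where \<F>: "finite \<F>" "\<F> \<subseteq> truth_set A ` two_valued A" "\<And>B. B \<in> \<F> \<Longrightarrow> P B"
    "topspace (hom_space A) \<subseteq> \<Union>\<F>"
    by (rule finite_subcover[OF closedin_topspace, of P]) (use local mono in \<open>simp_all add: topspace_hom_space\<close>)
  from \<F>(1-3) have "P (\<Union>\<F>)"
  proof (induction \<F>)
    case empty
    show ?case using mv_closedD(1)[OF A] by (auto simp: P_def)
  next
    case (insert B \<F>)
    from insert.prems obtain b where b: "b \<in> two_valued A" "B = truth_set A b" by blast
    have "P B" using insert.prems(2) by simp
    then obtain a1 where a1: "a1 \<in> carrier A" "\<forall>h\<in>B. h a1 = f h" unfolding P_def ..
    have "P (\<Union>\<F>)" using insert.prems by (intro insert.IH) simp_all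
    then obtain a2 where a2: "a2 \<in> carrier A" "\<forall>h\<in>\<Union>\<F>. h a2 = f h" unfolding P_def ..
    have bA: "b \<in> carrier A" using b by (simp add: two_valued_def)
    note nb = mv_closedD(2)[OF A bA]
    \<comment> \<open>Definition by cases: \<open>b\<close> has value 1 on \<open>B\<close> and 0
      off \<open>B\<close>, so this element agrees with \<open>a1\<close> on \<open>B\<close> and
      with \<open>a2\<close> elsewhere.\<close>
    define a where "a = mv_plus A (mv_odot A a1 b) (mv_odot A a2 (mv_neg A b))"
    have cl: "mv_odot A a1 b \<in> carrier A" "mv_odot A a2 (mv_neg A b) \<in> carrier A"
      by (intro mv_odot_closed A a1 a2 bA nb)+
    then have aA: "a \<in> carrier A" unfolding a_def by (intro mv_closedD A)
    have "h a = f h" if h: "h \<in> \<Union>(insert B \<F>)" for h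
    proof -
      have hh: "h \<in> mv_hom A L"
        using h insert.prems(1) unfolding truth_set_def by blast
      have "0 \<le> h a1" "h a1 \<le> 1" "0 \<le> h a2" "h a2 \<le> 1"
        using chain_bounds[OF mv_hom_chainD(2)[OF hh a1(1)]] chain_bounds[OF mv_hom_chainD(2)[OF hh a2(1)]] by simp_all
      moreover have "h b = 0 \<or> h b = 1" using b hh by (simp add: two_valued_def)
      ultimately have "h a = (if h b = 1 then h a1 else h a2)"
        unfolding a_def mv_hom_chainD(4)[OF hh cl] hom_odot[OF A a1(1) bA hh] hom_odot[OF A a2(1) nb hh]
          mv_hom_chainD(3)[OF hh bA] by auto
      moreover have "h \<in> B \<longleftrightarrow> h b = 1" using hh b(2) by (simp add: truth_set_def)
      moreover have "h \<in> B \<or> h \<in> \<Union>\<F>" using h by simp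
      ultimately show ?thesis using bspec[OF a1(2), of h] bspec[OF a2(2), of h] by (cases "h b = 1") simp_all
    qed
    then show ?case unfolding P_def using aA by blast
  qed
  then show ?thesis using \<F>(4) unfolding P_def topspace_hom_space by blast
qed

end

section \<open>The dual space functor\<close>

lemma somv_homD:
  assumes "f \<in> somv_hom n (X, V) (Y, U)"
  shows "continuous_map X Y f" "f \<in> extensional (topspace X)"
    "i \<in> {1..n - 1} \<Longrightarrow> x \<in> topspace X \<Longrightarrow> f x \<in> U i \<Longrightarrow> x \<in> V i"
  using assms by (auto simp: somv_hom_def)

lemma somv_homI:
  assumes "continuous_map X Y f" "f \<in> extensional (topspace X)"
    "\<And>i x. i \<in> {1..n - 1} \<Longrightarrow> x \<in> topspace X \<Longrightarrow> f x \<in> U i \<Longrightarrow> x \<in> V i"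
  shows "f \<in> somv_hom n (X, V) (Y, U)"
  using assms by (auto simp: somv_hom_def)

lemma compose_assoc_on:
  assumes "f \<in> A \<rightarrow> B"
  shows "compose A h (compose A g f) = compose A (compose B h g) f"
  using assms by (auto simp: compose_def fun_eq_iff)

lemma continuous_map_compose_on:
  assumes "continuous_map X Y f" "continuous_map Y Z g"
  shows "continuous_map X Z (compose (topspace X) g f)"
  by (rule continuous_map_eq[OF continuous_map_compose[OF assms]]) (simp add: compose_def)

section \<open>The two categories and isomorphisms of spaces\<close>

lemma BoolSOMV_is_category: "is_category (BoolSOMV_cat n :: ('b somv, 'b \<Rightarrow> 'b) cat)"
proof -
  have id: "restrict id (topspace X) \<in> somv_hom n (X, V) (X, V)" for X :: "'b topology" and V
    by (rule somv_homI) (auto intro: continuous_map_eq[OF continuous_map_id])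
  have comp: "compose (topspace X) g f \<in> somv_hom n (X, V) (Z, W)"
    if f: "f \<in> somv_hom n (X, V) (Y, U)" and g: "g \<in> somv_hom n (Y, U) (Z, W)"
    for f g and X Y Z :: "'b topology" and V U W
  proof (rule somv_homI)
    show "continuous_map X Z (compose (topspace X) g f)"
      by (rule continuous_map_compose_on[OF somv_homD(1)[OF f] somv_homD(1)[OF g]])
    fix i x assume i: "i \<in> {1..n - 1}" and x: "x \<in> topspace X" and "compose (topspace X) g f x \<in> W i"
    then have "g (f x) \<in> W i" by (simp add: compose_def)
    moreover have "f x \<in> topspace Y"
      using somv_homD(1)[OF f] x continuous_map_image_subset_topspace by blast
    ultimately show "x \<in> V i" using somv_homD(3)[OF f i x] somv_homD(3)[OF g i] by blast
  qed (simp add: compose_extensional)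
  have f_id: "compose (topspace X) f (restrict id (topspace X)) = f"
    "compose (topspace X) (restrict id (topspace Y)) f = f"
    if f: "f \<in> somv_hom n (X, V) (Y, U)" for f and X Y :: "'b topology" and V U
  proof -
    have "f x \<in> topspace Y" if "x \<in> topspace X" for x
      using somv_homD(1)[OF f] that continuous_map_image_subset_topspace by blast
    then show "compose (topspace X) f (restrict id (topspace X)) = f"
      "compose (topspace X) (restrict id (topspace Y)) f = f"
      using somv_homD(2)[OF f] by (auto simp: compose_def fun_eq_iff extensional_def)
  qed
  have assoc: "compose (topspace X) h (compose (topspace X) g f) = compose (topspace X) (compose (topspace Y) h g) f"
    if f: "f \<in> somv_hom n (X, V) (Y, U)" for f g h and X Y :: "'b topology" and V U
    by (rule compose_assoc_on) (use somv_homD(1)[OF f] in \<open>simp add: continuous_map_def\<close>)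
  show ?thesis
    unfolding is_category_def BoolSOMV_cat_def
    by (auto simp: id comp f_id assoc)
qed

lemma MV_is_category: "is_category (MV_cat n :: ('a mv_struct, 'a \<Rightarrow> 'a) cat)"
proof -
  have f_id: "compose (carrier A) f (restrict id (carrier A)) = f"
    "compose (carrier A) (restrict id (carrier B)) f = f"
    if f: "f \<in> mv_hom A B" for f and A B :: "'a mv_struct"
    using mv_homD(2,5)[OF f] by (auto simp: compose_def fun_eq_iff extensional_def)
  have assoc: "compose (carrier A) h (compose (carrier A) g f) = compose (carrier A) (compose (carrier B) h g) f"
    if f: "f \<in> mv_hom A B" for f g h and A B :: "'a mv_struct"
    by (rule compose_assoc_on) (use mv_homD(2)[OF f] in blast)
  show ?thesis
    unfolding is_category_def MV_cat_def
    by (auto simp: f_id assoc mv_hom_id mv_n1_algebra_closed mv_hom_compose[OF mv_n1_algebra_closed])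
qed

text \<open>A morphism only needs an inclusion between the open sets; the equivalence assumed here
  supplies the inclusions for the map and for its inverse.\<close>

lemma BoolSOMV_isoI:
  fixes X Y :: "'b topology"
  assumes f: "homeomorphic_map X Y f"
    and V: "\<And>i x. i \<in> {1..n - 1} \<Longrightarrow> x \<in> topspace X \<Longrightarrow> x \<in> V i \<longleftrightarrow> f x \<in> U i"
  shows "is_iso (BoolSOMV_cat n) (X, V) (Y, U) (restrict f (topspace X))"
proof -
  obtain g where g: "homeomorphic_maps X Y f g" using f homeomorphic_map_maps by blast
  have gf: "\<And>x. x \<in> topspace X \<Longrightarrow> g (f x) = x" and fg: "\<And>y. y \<in> topspace Y \<Longrightarrow> f (g y) = y"
    and cf: "continuous_map X Y f" and cg: "continuous_map Y X g"
    using g unfolding homeomorphic_maps_def by blast+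
  have fX: "f x \<in> topspace Y" if "x \<in> topspace X" for x
    using cf that continuous_map_image_subset_topspace by blast
  have gY: "g y \<in> topspace X" if "y \<in> topspace Y" for y
    using cg that continuous_map_image_subset_topspace by blast
  have "restrict f (topspace X) \<in> somv_hom n (X, V) (Y, U)"
    by (rule somv_homI) (auto simp: V intro: continuous_map_eq[OF cf])
  moreover have "restrict g (topspace Y) \<in> somv_hom n (Y, U) (X, V)"
  proof (rule somv_homI)
    show "continuous_map Y X (restrict g (topspace Y))"
      by (rule continuous_map_eq[OF cg]) simp
    fix i y assume "i \<in> {1..n - 1}" "y \<in> topspace Y" "restrict g (topspace Y) y \<in> V i"
    then show "y \<in> U i" using V[of i "g y"] gY[of y] fg[of y] by simp
  qed simp
  moreover have "compose (topspace X) (restrict g (topspace Y)) (restrict f (topspace X)) = restrict id (topspace X)"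
    "compose (topspace Y) (restrict f (topspace X)) (restrict g (topspace Y)) = restrict id (topspace Y)"
    by (auto simp: compose_def fun_eq_iff fX gY gf fg)
  ultimately show ?thesis
    unfolding is_iso_def BoolSOMV_cat_def by auto
qed

text \<open>
  A homomorphism into the chain is determined by the preimage of \<open>1\<close>, so that the points of the dual
  space can be coded by subsets of the algebra.
\<close>

locale chain_duality = chain_order n for n +
  fixes code :: "'a set \<Rightarrow> 'b"
  assumes inj_code: "inj code"
begin

definition pt :: "'a mv_struct \<Rightarrow> ('a \<Rightarrow> real) \<Rightarrow> 'b" where
  "pt A h = code {a \<in> carrier A. h a = 1}"

definition pts :: "'a mv_struct \<Rightarrow> 'b set" where
  "pts A = pt A ` mv_hom A L"

definition ev :: "'a mv_struct \<Rightarrow> 'b \<Rightarrow> 'a \<Rightarrow> real" where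
  "ev A = inv_into (mv_hom A L) (pt A)"

definition sp :: "'a mv_struct \<Rightarrow> 'b topology" where
  "sp A = pullback_topology (pts A) (ev A) (hom_space A)"

definition dual_obj :: "'a mv_struct \<Rightarrow> 'b somv" where
  "dual_obj A = (sp A, \<lambda>i\<in>{1..n - 1}. {p \<in> pts A. \<exists>a\<in>carrier A. ev A p a = real i / real n})"

definition dual_arr :: "'a mv_struct \<Rightarrow> 'a mv_struct \<Rightarrow> ('a \<Rightarrow> 'a) \<Rightarrow> 'b \<Rightarrow> 'b" where
  "dual_arr A B f = (\<lambda>p\<in>pts A. pt B (compose (carrier B) (ev A p) f))"

text \<open>Distinct homomorphisms are separated by a two-valued element, which lies in exactly one
  of the two preimages of 1.\<close>

lemma inj_on_pt:
  assumes A: "mv_closed A"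
  shows "inj_on (pt A) (mv_hom A L)"
proof (rule inj_onI, rule ccontr)
  fix h g assume h: "h \<in> mv_hom A L" and g: "g \<in> mv_hom A L" and eq: "pt A h = pt A g" and "h \<noteq> g"
  then obtain b where b: "b \<in> two_valued A" "h b = 0" "g b = 1"
    using two_valued_separator_neq[OF A h g] by blast
  have "{a \<in> carrier A. h a = 1} = {a \<in> carrier A. g a = 1}"
    using eq injD[OF inj_code] unfolding pt_def by blast
  moreover have "b \<in> {a \<in> carrier A. g a = 1}" "b \<notin> {a \<in> carrier A. h a = 1}"
    using b by (simp_all add: two_valued_def)
  ultimately show False by simp
qed

lemma ev_pt: "mv_closed A \<Longrightarrow> h \<in> mv_hom A L \<Longrightarrow> ev A (pt A h) = h"
  unfolding ev_def by (rule inv_into_f_f[OF inj_on_pt])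

lemma pt_mem: "h \<in> mv_hom A L \<Longrightarrow> pt A h \<in> pts A"
  by (simp add: pts_def)

lemma ev_mem: "p \<in> pts A \<Longrightarrow> ev A p \<in> mv_hom A L"
  unfolding pts_def ev_def by (rule inv_into_into)

lemma pt_ev: "p \<in> pts A \<Longrightarrow> pt A (ev A p) = p"
  unfolding pts_def ev_def using f_inv_into_f[of p "pt A" "mv_hom A L"] by simp

lemma topspace_sp: "topspace (sp A) = pts A"
  unfolding sp_def topspace_pullback_topology topspace_hom_space using ev_mem by blast

lemma homeomorphic_maps_pt:
  assumes A: "mv_closed A"
  shows "homeomorphic_maps (hom_space A) (sp A) (pt A) (ev A)"
  unfolding homeomorphic_maps_def topspace_sp topspace_hom_space
proof (intro conjI ballI)
  show "continuous_map (sp A) (hom_space A) (ev A)"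
    using continuous_map_pullback[OF continuous_map_id[of "hom_space A"], of "pts A" "ev A"]
    by (simp add: sp_def)
  show "continuous_map (hom_space A) (sp A) (pt A)"
    unfolding sp_def
  proof (rule continuous_map_pullback')
    show "continuous_map (hom_space A) (hom_space A) (ev A \<circ> pt A)"
      by (rule continuous_map_eq[OF continuous_map_id]) (simp add: topspace_hom_space ev_pt[OF A])
    show "topspace (hom_space A) \<subseteq> pt A -` pts A"
      unfolding topspace_hom_space using pt_mem by blast
  qed
qed (simp_all add: ev_pt[OF A] pt_ev)

lemma homeomorphic_map_pt: "mv_closed A \<Longrightarrow> homeomorphic_map (hom_space A) (sp A) (pt A)"
  using homeomorphic_maps_pt homeomorphic_map_maps by blast

lemma continuous_map_pt: "mv_closed A \<Longrightarrow> continuous_map (hom_space A) (sp A) (pt A)"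
  and continuous_map_ev: "mv_closed A \<Longrightarrow> continuous_map (sp A) (hom_space A) (ev A)"
  using homeomorphic_maps_pt unfolding homeomorphic_maps_def by blast+

lemma openin_ev_fibre:
  assumes A: "mv_closed A" and a: "a \<in> carrier A"
  shows "openin (sp A) {p \<in> pts A. ev A p a = c}"
proof -
  have "openin (sp A) {p \<in> topspace (sp A). ev A p \<in> {h \<in> mv_hom A L. h a = c}}"
    by (rule openin_continuous_map_preimage[OF continuous_map_ev[OF A] openin_hom_space_fibre[OF a]])
  moreover have "{p \<in> topspace (sp A). ev A p \<in> {h \<in> mv_hom A L. h a = c}} = {p \<in> pts A. ev A p a = c}"
    unfolding topspace_sp using ev_mem by blast
  ultimately show ?thesis by simp
qed

text \<open>The values of a homomorphism form a subalgebra of the chain. Negation of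
  \<open>a\<close> realises \<open>(n - i)/n\<close>, and the implication
  \<open>mv_plus A (mv_neg A a) b\<close> realises \<open>(n - i + k)/n\<close>.\<close>

lemma dual_obj_somv:
  assumes A: "mv_closed A"
  shows "somv_object n (dual_obj A)"
proof -
  interpret separating_clopen_algebra "hom_space A" "truth_set A ` two_valued A"
    by (rule hom_space_separating_clopen_algebra[OF A])
  define V where "V = (\<lambda>i\<in>{1..n - 1}. {p \<in> pts A. \<exists>a\<in>carrier A. ev A p a = real i / real n})"
  have V: "V i = {p \<in> pts A. \<exists>a\<in>carrier A. ev A p a = real i / real n}" if "i \<in> {1..n - 1}" for i
    using that by (simp add: V_def)
  have "openin (sp A) (V i)" if i: "i \<in> {1..n - 1}" for i
  proof -
    have "V i = (\<Union>a\<in>carrier A. {p \<in> pts A. ev A p a = real i / real n})"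
      unfolding V[OF i] by blast
    also have "openin (sp A) \<dots>" using openin_ev_fibre[OF A] by blast
    finally show ?thesis .
  qed
  moreover have "V i \<subseteq> V (n - i)" if i: "i \<in> {1..n - 1}" for i
  proof
    have ni: "n - i \<in> {1..n - 1}" using i by auto
    fix p assume "p \<in> V i"
    then obtain a where p: "p \<in> pts A" and a: "a \<in> carrier A" "ev A p a = real i / real n"
      unfolding V[OF i] by blast
    have "real (n - i) = real n - real i" using i by (intro of_nat_diff) auto
    then have "ev A p (mv_neg A a) = real (n - i) / real n"
      using mv_hom_chainD(3)[OF ev_mem[OF p] a(1)] a(2) n_pos
      by (simp add: field_simps)
    with p mv_closedD(2)[OF A a(1)] show "p \<in> V (n - i)" unfolding V[OF ni] by blast
  qed
  moreover have "V i = V (n - i)" if i: "i \<in> {1..n - 1}" for i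
  proof -
    have "n - i \<in> {1..n - 1}" "n - (n - i) = i" using i by auto
    then show ?thesis using calculation(2)[OF i] calculation(2)[of "n - i"] by simp
  qed
  moreover have "V i \<inter> V k \<subseteq> V (n - i + k)"
    if ik: "3 \<le> i \<and> i \<le> n - 1 \<and> 1 \<le> k \<and> k \<le> n - 3 \<and> k < i" for i k
  proof
    have mem: "i \<in> {1..n - 1}" "k \<in> {1..n - 1}" "n - i + k \<in> {1..n - 1}" using ik by auto
    fix p assume "p \<in> V i \<inter> V k"
    then obtain a b where p: "p \<in> pts A" and a: "a \<in> carrier A" "ev A p a = real i / real n"
      and b: "b \<in> carrier A" "ev A p b = real k / real n"
      unfolding V[OF mem(1)] V[OF mem(2)] by blast
    \<comment> \<open>Because \<open>k < i\<close>, the sum \<open>1 - i/n + k/n\<close> stays below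
      1 and is not truncated.\<close>
    have "real k < real i" "real (n - i) = real n - real i" using ik by (auto simp: of_nat_diff)
    then have "ev A p (mv_plus A (mv_neg A a) b) = real (n - i + k) / real n"
      using mv_hom_chainD(3)[OF ev_mem[OF p] a(1)] mv_hom_chainD(4)[OF ev_mem[OF p] mv_closedD(2)[OF A a(1)] b(1)]
        a(2) b(2) n_pos
      by (simp add: field_simps min_def)
    with p mv_closedD(3)[OF A mv_closedD(2)[OF A a(1)] b(1)] show "p \<in> V (n - i + k)"
      unfolding V[OF mem(3)] by blast
  qed
  moreover have "boolean_space (sp A)"
    by (rule homeomorphic_boolean_space[OF homeomorphic_map_pt[OF A] boolean])
  moreover have "V \<in> extensional {1..n - 1}" by (simp add: V_def)
  ultimately have "somv_object n (sp A, V)"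
    unfolding somv_object_def by (simp add: PiE_iff)
  then show ?thesis by (simp add: dual_obj_def V_def)
qed

text \<open>Each clopen set is the truth set of some element of the algebra, so the dual space meets
  the size bound of the full subcategory.\<close>

lemma clopens_sp_lepoll:
  assumes A: "mv_closed A"
  shows "clopens (sp A) \<lesssim> (UNIV :: 'a set)"
proof -
  interpret separating_clopen_algebra "hom_space A" "truth_set A ` two_valued A"
    by (rule hom_space_separating_clopen_algebra[OF A])
  have "clopens (sp A) = (\<lambda>b. pt A ` truth_set A b) ` two_valued A"
    unfolding homeomorphic_map_clopens[OF homeomorphic_map_pt[OF A]] clopens_eq by (simp add: image_image)
  also have "\<dots> \<lesssim> two_valued A" by (rule image_lepoll)
  also have "\<dots> \<lesssim> (UNIV :: 'a set)" by (rule subset_imp_lepoll) simp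
  finally show ?thesis .
qed

section \<open>The functor on morphisms, faithfulness and fullness\<close>

lemma compose_mem:
  assumes "mv_closed B" "f \<in> mv_hom B A" "p \<in> pts A"
  shows "compose (carrier B) (ev A p) f \<in> mv_hom B L"
  by (rule mv_hom_compose[OF assms(1,2) ev_mem[OF assms(3)]])

lemma ev_dual_arr:
  assumes "mv_closed B" "f \<in> mv_hom B A" "p \<in> pts A"
  shows "ev B (dual_arr A B f p) = compose (carrier B) (ev A p) f"
  using compose_mem[OF assms] assms by (simp add: dual_arr_def ev_pt)

lemma dual_arr_mem:
  assumes "mv_closed B" "f \<in> mv_hom B A" "p \<in> pts A"
  shows "dual_arr A B f p \<in> pts B"
  using compose_mem[OF assms] assms by (simp add: dual_arr_def pt_mem)

text \<open>The value of a composite at \<open>b\<close> is a value of the original homomorphism,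
  namely at \<open>f b\<close>; this is the condition on the open sets. Continuity is checked in
  each coordinate.\<close>

lemma dual_arr_hom:
  assumes A: "mv_closed A" and B: "mv_closed B" and f: "f \<in> mv_hom B A"
  shows "dual_arr A B f \<in> somv_hom n (dual_obj A) (dual_obj B)"
  unfolding dual_obj_def
proof (rule somv_homI)
  have "continuous_map (sp A) (hom_space B) (\<lambda>p. compose (carrier B) (ev A p) f)"
  proof (rule continuous_map_into_hom_space)
    fix p assume "p \<in> topspace (sp A)"
    then show "compose (carrier B) (ev A p) f \<in> mv_hom B L"
      by (intro compose_mem B f) (simp add: topspace_sp)
  next
    fix b assume b: "b \<in> carrier B"
    have "continuous_map (sp A) (discrete_topology (carrier L)) ((\<lambda>h. h (f b)) \<circ> ev A)"
      by (rule continuous_map_compose[OF continuous_map_ev[OF A] continuous_map_hom_space_eval[OF mv_homD(2)[OF f b]]])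
    then show "continuous_map (sp A) (discrete_topology (carrier L)) (\<lambda>p. compose (carrier B) (ev A p) f b)"
      using b by (simp add: compose_def o_def)
  qed
  from continuous_map_compose[OF this continuous_map_pt[OF B]]
  show "continuous_map (sp A) (sp B) (dual_arr A B f)"
    by (rule continuous_map_eq) (simp add: topspace_sp dual_arr_def)
  show "dual_arr A B f \<in> extensional (topspace (sp A))"
    by (simp add: topspace_sp dual_arr_def)
next
  fix i p assume i: "i \<in> {1..n - 1}" and "p \<in> topspace (sp A)"
    and mem: "dual_arr A B f p \<in> (\<lambda>i\<in>{1..n - 1}. {p \<in> pts B. \<exists>a\<in>carrier B. ev B p a = real i / real n}) i"
  then have p: "p \<in> pts A" by (simp add: topspace_sp)
  from mem i obtain b where b: "b \<in> carrier B" "ev B (dual_arr A B f p) b = real i / real n" by auto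
  then have "ev A p (f b) = real i / real n"
    unfolding ev_dual_arr[OF B f p] by (simp add: compose_def)
  with i p mv_homD(2)[OF f b(1)]
  show "p \<in> (\<lambda>i\<in>{1..n - 1}. {p \<in> pts A. \<exists>a\<in>carrier A. ev A p a = real i / real n}) i" by auto
qed

lemma dual_arr_id:
  assumes A: "mv_closed A"
  shows "dual_arr A A (restrict id (carrier A)) = restrict id (topspace (sp A))"
proof (rule ext)
  fix p
  show "dual_arr A A (restrict id (carrier A)) p = restrict id (topspace (sp A)) p"
  proof (cases "p \<in> pts A")
    case True
    have "compose (carrier A) (ev A p) (restrict id (carrier A)) = ev A p"
      using mv_homD(5)[OF ev_mem[OF True]] by (auto simp: compose_def fun_eq_iff extensional_def)
    with True show ?thesis by (simp add: dual_arr_def topspace_sp pt_ev)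
  qed (simp add: dual_arr_def topspace_sp)
qed

lemma dual_arr_compose:
  assumes B: "mv_closed B" and C: "mv_closed C" and f: "f \<in> mv_hom B A" and g: "g \<in> mv_hom C B"
  shows "dual_arr A C (compose (carrier C) f g) = compose (topspace (sp A)) (dual_arr B C g) (dual_arr A B f)"
proof (rule ext)
  fix p
  show "dual_arr A C (compose (carrier C) f g) p = compose (topspace (sp A)) (dual_arr B C g) (dual_arr A B f) p"
  proof (cases "p \<in> pts A")
    case True
    have "compose (carrier C) (ev A p) (compose (carrier C) f g)
      = compose (carrier C) (compose (carrier B) (ev A p) f) g"
      by (rule compose_assoc_on) (use mv_homD(2)[OF g] in blast)
    also have "\<dots> = compose (carrier C) (ev B (dual_arr A B f p)) g"
      by (simp only: ev_dual_arr[OF B f True])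
    finally show ?thesis
      using True dual_arr_mem[OF B f True] by (simp add: dual_arr_def[of A C] dual_arr_def[of B C] compose_eq topspace_sp)
  qed (simp add: dual_arr_def compose_def topspace_sp)
qed

text \<open>Equal dual maps give \<open>h o f = h o g\<close> for every homomorphism
  \<open>h\<close> from \<open>A\<close> to the chain, and these separate the points of
  \<open>A\<close>.\<close>

lemma dual_arr_faithful:
  assumes A: "mv_n1_algebra n A" and B: "mv_closed B" and f: "f \<in> mv_hom B A" and g: "g \<in> mv_hom B A"
    and eq: "dual_arr A B f = dual_arr A B g"
  shows "f = g"
proof (rule mv_hom_eqI[OF f g], rule ccontr)
  fix b assume b: "b \<in> carrier B" and "f b \<noteq> g b"
  then obtain h where h: "h \<in> mv_hom A L" "h (f b) \<noteq> h (g b)"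
    using mv_hom_separating[OF A mv_homD(2)[OF f b] mv_homD(2)[OF g b]] by blast
  note p = pt_mem[OF h(1)] and ev = ev_pt[OF mv_n1_algebra_closed[OF A] h(1)]
  have "compose (carrier B) h f = compose (carrier B) h g"
    using ev_dual_arr[OF B f p] ev_dual_arr[OF B g p] unfolding ev eq by simp
  then have "compose (carrier B) h f b = compose (carrier B) h g b" by (rule fun_cong)
  with b h(2) show False by (simp add: compose_def)
qed

lemma dual_arr_full:
  assumes A: "mv_n1_algebra n A" and B: "mv_closed B"
    and \<phi>: "\<phi> \<in> somv_hom n (dual_obj A) (dual_obj B)"
  shows "\<exists>f\<in>mv_hom B A. dual_arr A B f = \<phi>"
proof -
  note cA = mv_n1_algebra_closed[OF A]
  note \<phi> = somv_homD[OF \<phi>[unfolded dual_obj_def]]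
  have \<phi>_mem: "\<phi> p \<in> pts B" if "p \<in> pts A" for p
    using continuous_map_image_subset_topspace[OF \<phi>(1)] that unfolding topspace_sp by blast
  \<comment> \<open>The given map read on homomorphisms. The preimage \<open>f\<close> of
    \<open>\<phi>\<close> has to satisfy \<open>h (f b) = T h b\<close> for all \<open>h\<close>, so
    \<open>f b\<close> is found by representing \<open>T h b\<close> as a function of
    \<open>h\<close>.\<close>
  define T where "T h = ev B (\<phi> (pt A h))" for h
  have T: "T h \<in> mv_hom B L" if "h \<in> mv_hom A L" for h
    unfolding T_def by (rule ev_mem[OF \<phi>_mem[OF pt_mem[OF that]]])
  have "\<exists>a\<in>carrier A. \<forall>h\<in>mv_hom A L. h a = T h b" if b: "b \<in> carrier B" for b
  proof (rule hom_space_representable[OF cA])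
    fix c
    have "openin (hom_space A) {h \<in> topspace (hom_space A). (\<phi> \<circ> pt A) h \<in> {p \<in> pts B. ev B p b = c}}"
      by (rule openin_continuous_map_preimage[OF continuous_map_compose[OF continuous_map_pt[OF cA] \<phi>(1)] openin_ev_fibre[OF B b]])
    moreover have "{h \<in> topspace (hom_space A). (\<phi> \<circ> pt A) h \<in> {p \<in> pts B. ev B p b = c}} = {h \<in> mv_hom A L. T h b = c}"
      using \<phi>_mem pt_mem unfolding topspace_hom_space T_def by auto
    ultimately show "openin (hom_space A) {h \<in> mv_hom A L. T h b = c}" by simp
  next
    fix h assume h: "h \<in> mv_hom A L"
    \<comment> \<open>The values 0 and 1 are taken by \<open>h\<close> at the constants. For
      \<open>i/n\<close>, the image point lies in the \<open>i\<close>-th open set of the dual of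
      \<open>B\<close>, so the morphism condition puts \<open>pt A h\<close> into that of
      \<open>A\<close>, which says that \<open>h\<close> takes this value.\<close>
    consider "T h b = 0" | "T h b = 1" | i where "i \<in> {1..n - 1}" "T h b = real i / real n"
      using chain_cases[OF mv_hom_chainD(2)[OF T[OF h] b]] by blast
    then show "\<exists>a\<in>carrier A. h a = T h b"
    proof cases
      case 1
      then show ?thesis
        using mv_closedD(1)[OF cA] mv_hom_chainD(1)[OF h] by (intro bexI[of _ "mv_zero A"]) simp_all
    next
      case 2
      then show ?thesis
        using mv_closedD(1,2)[OF cA] mv_hom_chainD(1)[OF h] mv_hom_chainD(3)[OF h]
        by (intro bexI[of _ "mv_neg A (mv_zero A)"]) simp_all
    next
      case 3
      have p: "pt A h \<in> pts A" by (rule pt_mem[OF h])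
      have "pt A h \<in> (\<lambda>i\<in>{1..n - 1}. {p \<in> pts A. \<exists>a\<in>carrier A. ev A p a = real i / real n}) i"
      proof (rule \<phi>(3)[OF 3(1)])
        show "\<phi> (pt A h) \<in> (\<lambda>i\<in>{1..n - 1}. {p \<in> pts B. \<exists>a\<in>carrier B. ev B p a = real i / real n}) i"
          using 3 b \<phi>_mem[OF p] unfolding T_def by auto
      qed (simp add: topspace_sp p)
      with 3 show ?thesis using ev_pt[OF cA h] by auto
    qed
  qed
  then obtain f0 where f0: "\<And>b. b \<in> carrier B \<Longrightarrow> f0 b \<in> carrier A"
    "\<And>b h. b \<in> carrier B \<Longrightarrow> h \<in> mv_hom A L \<Longrightarrow> h (f0 b) = T h b"
    by metis
  \<comment> \<open>Preservation of an operation may be checked after applying every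
    \<open>h\<close>, where it becomes the fact that \<open>T h\<close> is a homomorphism.\<close>
  have sep: "x = y" if "x \<in> carrier A" "y \<in> carrier A" "\<And>h. h \<in> mv_hom A L \<Longrightarrow> h x = h y" for x y
    using mv_hom_separating[OF A that(1,2)] that(3) by blast
  define f where "f = restrict f0 (carrier B)"
  have "f \<in> mv_hom B A"
    unfolding mv_hom_def
  proof (intro CollectI conjI ballI)
    show "f \<in> carrier B \<rightarrow>\<^sub>E carrier A" using f0(1) by (simp add: f_def)
  next
    fix x y assume xy: "x \<in> carrier B" "y \<in> carrier B"
    note pl = mv_closedD(3)[OF B xy]
    have "f0 (mv_plus B x y) = mv_plus A (f0 x) (f0 y)"
    proof (rule sep)
      fix h assume h: "h \<in> mv_hom A L"
      show "h (f0 (mv_plus B x y)) = h (mv_plus A (f0 x) (f0 y))"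
        unfolding f0(2)[OF pl h] mv_hom_chainD(4)[OF T[OF h] xy] mv_hom_chainD(4)[OF h f0(1)[OF xy(1)] f0(1)[OF xy(2)]]
          f0(2)[OF xy(1) h] f0(2)[OF xy(2) h] ..
    qed (simp_all add: f0(1) pl xy mv_closedD(3)[OF cA])
    then show "f (mv_plus B x y) = mv_plus A (f x) (f y)" by (simp add: f_def xy pl)
  next
    fix x assume x: "x \<in> carrier B"
    note nx = mv_closedD(2)[OF B x]
    have "f0 (mv_neg B x) = mv_neg A (f0 x)"
    proof (rule sep)
      fix h assume h: "h \<in> mv_hom A L"
      show "h (f0 (mv_neg B x)) = h (mv_neg A (f0 x))"
        unfolding f0(2)[OF nx h] mv_hom_chainD(3)[OF T[OF h] x] mv_hom_chainD(3)[OF h f0(1)[OF x]] f0(2)[OF x h] ..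
    qed (simp_all add: f0(1) nx x mv_closedD(2)[OF cA])
    then show "f (mv_neg B x) = mv_neg A (f x)" by (simp add: f_def x nx)
  next
    note z = mv_closedD(1)[OF B]
    have "f0 (mv_zero B) = mv_zero A"
    proof (rule sep)
      fix h assume h: "h \<in> mv_hom A L"
      show "h (f0 (mv_zero B)) = h (mv_zero A)"
        unfolding f0(2)[OF z h] mv_hom_chainD(1)[OF T[OF h]] mv_hom_chainD(1)[OF h] ..
    qed (simp_all add: f0(1) z mv_closedD(1)[OF cA])
    then show "f (mv_zero B) = mv_zero A" by (simp add: f_def z)
  qed
  moreover have "dual_arr A B f = \<phi>"
  proof (rule extensionalityI)
    show "dual_arr A B f \<in> extensional (pts A)" by (simp add: dual_arr_def)
    show "\<phi> \<in> extensional (pts A)" using \<phi>(2) by (simp add: topspace_sp)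
    fix p assume p: "p \<in> pts A"
    have "compose (carrier B) (ev A p) f = T (ev A p)"
    proof (rule extensionalityI[OF compose_extensional mv_homD(5)[OF T[OF ev_mem[OF p]]]])
      fix b assume b: "b \<in> carrier B"
      then show "compose (carrier B) (ev A p) f b = T (ev A p) b"
        using f0(2)[OF b ev_mem[OF p]] by (simp add: compose_def f_def)
    qed
    then show "dual_arr A B f p = \<phi> p"
      using p by (simp add: dual_arr_def T_def pt_ev \<phi>_mem)
  qed
  ultimately show ?thesis by blast
qed

end

section \<open>The algebra of admissible functions\<close>

locale somv_space = chain_order n for n +
  fixes X :: "'b topology" and V :: "nat \<Rightarrow> 'b set"
  assumes somv: "somv_object n (X, V)"
begin

lemma boolean: "boolean_space X"
  and V_open: "i \<in> {1..n - 1} \<Longrightarrow> openin X (V i)"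
  and V_sym: "i \<in> {1..n - 1} \<Longrightarrow> V i = V (n - i)"
  and V_imp: "3 \<le> i \<Longrightarrow> i \<le> n - 1 \<Longrightarrow> 1 \<le> k \<Longrightarrow> k \<le> n - 3 \<Longrightarrow> k < i \<Longrightarrow> V i \<inter> V k \<subseteq> V (n - i + k)"
  using somv unfolding somv_object_def by blast+

lemma compact: "compact_space X" and Hausdorff: "Hausdorff_space X"
  and clopen_neighbourhood: "openin X U \<Longrightarrow> x \<in> U \<Longrightarrow> \<exists>C\<in>clopens X. x \<in> C \<and> C \<subseteq> U"
  using boolean unfolding boolean_space_alt by blast+

text \<open>The subalgebra of the chain attached to \<open>x\<close>. The indices 0 and
  \<open>n\<close> lie outside \<open>{1..n - 1}\<close>, so 0 and 1 are always admissible.\<close>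

definition admissible :: "'b \<Rightarrow> real set" where
  "admissible x = {real i / real n | i. i \<le> n \<and> (i \<in> {1..n - 1} \<longrightarrow> x \<in> V i)}"

lemma admissible_chain: "admissible x \<subseteq> carrier L"
  by (auto simp: admissible_def chain_carrier)

lemma admissible_iff: "i \<in> {1..n - 1} \<Longrightarrow> real i / real n \<in> admissible x \<longleftrightarrow> x \<in> V i"
  using n_pos by (auto simp: admissible_def)

lemma admissible_zero: "0 \<in> admissible x" and admissible_one: "1 \<in> admissible x"
proof -
  show "0 \<in> admissible x" unfolding admissible_def by (intro CollectI exI[of _ 0]) simp
  have "n \<notin> {1..n - 1}" using n_pos by auto
  then show "1 \<in> admissible x" unfolding admissible_def using n_pos by (intro CollectI exI[of _ n]) simp
qed

lemma admissible_neg: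
  assumes "c \<in> admissible x" shows "1 - c \<in> admissible x"
proof -
  obtain i where i: "c = real i / real n" "i \<le> n" "i \<in> {1..n - 1} \<longrightarrow> x \<in> V i"
    using assms unfolding admissible_def by blast
  have "1 - c = real (n - i) / real n" using i n_pos by (simp add: of_nat_diff field_simps)
  moreover have "n - i \<in> {1..n - 1} \<longrightarrow> x \<in> V (n - i)"
  proof
    assume "n - i \<in> {1..n - 1}"
    then have "i \<in> {1..n - 1}" by auto
    with i V_sym show "x \<in> V (n - i)" by blast
  qed
  ultimately show ?thesis unfolding admissible_def by (intro CollectI exI[of _ "n - i"]) simp
qed

text \<open>
  With \<open>i\<close> replaced by \<open>n - i\<close>, the last condition on the open sets says \<open>V i \<inter> V k \<subseteq> V (i + k)\<close>.
  Outside its index range one of \<open>i\<close>, \<open>k\<close> is \<open>1\<close> and \<open>i + k = n - 1\<close>, where \<open>V (n - 1) = V 1\<close>.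
\<close>

lemma V_plus:
  assumes i: "1 \<le> i" "x \<in> V i" and k: "1 \<le> k" "x \<in> V k" and ik: "i + k < n"
  shows "x \<in> V (i + k)"
proof -
  have mem: "x \<in> V (n - i)" using i ik V_sym[of i] by auto
  consider "3 \<le> n - i" "k \<le> n - 3" | "i + k = n - 1" "k = 1" | "i + k = n - 1" "i = 1"
    using i(1) k(1) ik by linarith
  then show ?thesis
  proof cases
    case 1
    moreover have "n - i \<le> n - 1" "k < n - i" "n - (n - i) + k = i + k" using i(1) ik by auto
    ultimately show ?thesis using V_imp[of "n - i" k] mem k by auto
  next
    case 2
    then show ?thesis using V_sym[of 1] k ik by auto
  next
    case 3
    then show ?thesis using V_sym[of 1] i ik by auto
  qed
qed

lemma admissible_plus:
  assumes "c \<in> admissible x" "d \<in> admissible x" shows "min 1 (c + d) \<in> admissible x"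
proof -
  obtain i where i: "c = real i / real n" "i \<le> n" "i \<in> {1..n - 1} \<longrightarrow> x \<in> V i"
    using assms(1) unfolding admissible_def by blast
  obtain k where k: "d = real k / real n" "k \<le> n" "k \<in> {1..n - 1} \<longrightarrow> x \<in> V k"
    using assms(2) unfolding admissible_def by blast
  have cd: "c + d = real (i + k) / real n" by (simp add: i k add_divide_distrib)
  show ?thesis
  proof (cases "i + k < n")
    case False
    then have "min 1 (c + d) = 1" using n_pos unfolding cd by (simp add: field_simps)
    then show ?thesis using admissible_one by simp
  next
    case True
    have "x \<in> V (i + k)" if "i + k \<in> {1..n - 1}"
    proof (cases "i = 0 \<or> k = 0")
      case True
      then show ?thesis using i k that by auto
    next
      case False
      then show ?thesis using V_plus[of i x k] i k True by auto
    qed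
    moreover have "min 1 (c + d) = real (i + k) / real n" using True n_pos unfolding cd by (simp add: field_simps)
    ultimately show ?thesis
      unfolding admissible_def using True by (intro CollectI exI[of _ "i + k"]) simp
  qed
qed

text \<open>Openness of the fibres expresses continuity into the discrete chain; fibres over reals
  outside the chain are empty.\<close>

definition funs :: "('b \<Rightarrow> real) set" where
  "funs = {f \<in> \<Pi>\<^sub>E x\<in>topspace X. admissible x. \<forall>c. openin X {x \<in> topspace X. f x = c}}"

lemma funsD:
  assumes "f \<in> funs"
  shows "x \<in> topspace X \<Longrightarrow> f x \<in> admissible x" "openin X {x \<in> topspace X. f x = c}"
    "f \<in> extensional (topspace X)" "x \<in> topspace X \<Longrightarrow> f x \<in> carrier L"
  using assms admissible_chain unfolding funs_def PiE_def by blast+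

lemma funsI:
  assumes "\<And>x. x \<in> topspace X \<Longrightarrow> f x \<in> admissible x" "\<And>c. openin X {x \<in> topspace X. f x = c}"
  shows "restrict f (topspace X) \<in> funs"
proof -
  have "{x \<in> topspace X. restrict f (topspace X) x = c} = {x \<in> topspace X. f x = c}" for c by auto
  with assms show ?thesis unfolding funs_def by auto
qed

lemma funs_const: "c = 0 \<or> c = 1 \<Longrightarrow> (\<lambda>x\<in>topspace X. c) \<in> funs"
proof (rule funsI)
  show "openin X {x \<in> topspace X. c = d}" for d by (cases "c = d") auto
qed (auto simp: admissible_zero admissible_one)

lemma funs_neg:
  assumes f: "f \<in> funs" shows "(\<lambda>x\<in>topspace X. 1 - f x) \<in> funs"
proof (rule funsI)
  fix c
  have "{x \<in> topspace X. 1 - f x = c} = {x \<in> topspace X. f x = 1 - c}" by auto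
  then show "openin X {x \<in> topspace X. 1 - f x = c}" using funsD(2)[OF f] by simp
qed (intro admissible_neg funsD(1)[OF f])

lemma funs_plus:
  assumes f: "f \<in> funs" and g: "g \<in> funs" shows "(\<lambda>x\<in>topspace X. min 1 (f x + g x)) \<in> funs"
proof (rule funsI)
  fix c
  have "{x \<in> topspace X. min 1 (f x + g x) = c} =
    (\<Union>(a, b)\<in>{(a, b). min 1 (a + b) = c}. {x \<in> topspace X. f x = a} \<inter> {x \<in> topspace X. g x = b})" by auto
  also have "openin X \<dots>" by (intro openin_Union) (auto intro!: openin_Int funsD(2)[OF f] funsD(2)[OF g])
  finally show "openin X {x \<in> topspace X. min 1 (f x + g x) = c}" .
qed (intro admissible_plus funsD(1)[OF f] funsD(1)[OF g])

text \<open>The supply of functions: with \<open>i = n\<close> these are indicators of clopen sets,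
  which separate points; with \<open>i < n\<close> they realise the value \<open>i/n\<close> near
  any point of \<open>V i\<close>.\<close>

lemma funs_step:
  assumes C: "C \<in> clopens X" and i: "i \<le> n" and Ci: "i \<in> {1..n - 1} \<Longrightarrow> C \<subseteq> V i"
  shows "(\<lambda>x\<in>topspace X. if x \<in> C then real i / real n else 0) \<in> funs"
proof (rule funsI)
  fix c
  have "openin X (topspace X - C)" "openin X C" using C by auto
  moreover have "C \<subseteq> topspace X" using C openin_subset by blast
  then have "{x \<in> topspace X. (if x \<in> C then real i / real n else 0) = c} =
    (if real i / real n = c then C else {}) \<union> (if 0 = c then topspace X - C else {})" by auto
  ultimately show "openin X {x \<in> topspace X. (if x \<in> C then real i / real n else 0) = c}"
    by (auto intro: openin_Un)
next
  fix x
  have "real i / real n \<in> admissible x" if "x \<in> C"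
    using i Ci that unfolding admissible_def by blast
  then show "(if x \<in> C then real i / real n else 0) \<in> admissible x" using admissible_zero by simp
qed

lemma fibre_clopen:
  assumes f: "f \<in> funs" shows "{x \<in> topspace X. f x = c} \<in> clopens X"
proof -
  have "topspace X - {x \<in> topspace X. f x = c} = (\<Union>d\<in>-{c}. {x \<in> topspace X. f x = d})" by auto
  also have "openin X \<dots>" using funsD(2)[OF f] by blast
  finally show ?thesis using funsD(2)[OF f] by (auto simp: closedin_def)
qed

text \<open>A function is determined by its \<open>n + 1\<close> fibres over the chain. Each is
  clopen and so is named by an element of \<open>'a\<close>, and an infinite type absorbs tuples of
  fixed length.\<close>

lemma funs_lepoll:
  assumes inf: "infinite (UNIV :: 'a set)" and le: "clopens X \<lesssim> (UNIV :: 'a set)"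
  shows "funs \<lesssim> (UNIV :: 'a set)"
proof -
  obtain g :: "'b set \<Rightarrow> 'a" where g: "inj_on g (clopens X)"
    using le unfolding lepoll_def by blast
  obtain p :: "'a \<times> 'a \<Rightarrow> 'a" where p: "inj p"
    using card_of_ordIso[THEN iffD2, OF card_of_Times_same_infinite[OF inf]]
    by (auto simp: bij_betw_def)
  \<comment> \<open>Iterated pairing is injective among lists of one length, which suffices since
    every \<open>F f\<close> has length \<open>n + 1\<close>; the value at the end of the list is
    arbitrary.\<close>
  define enc where "enc xs = foldr (\<lambda>x y. p (x, y)) xs undefined" for xs
  have enc: "length xs = length ys \<Longrightarrow> enc xs = enc ys \<Longrightarrow> xs = ys" for xs ys
    by (induction xs ys rule: list_induct2) (auto simp: enc_def dest!: injD[OF p])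
  define F where "F f = map (\<lambda>i. g {x \<in> topspace X. f x = real i / real n}) [0..<Suc n]" for f
  have "inj_on (\<lambda>f. enc (F f)) funs"
  proof (rule inj_onI)
    fix f h assume f: "f \<in> funs" and h: "h \<in> funs" and "enc (F f) = enc (F h)"
    then have "F f = F h" by (intro enc) (simp_all add: F_def)
    then have eq: "{x \<in> topspace X. f x = real i / real n} = {x \<in> topspace X. h x = real i / real n}" if "i \<le> n" for i
      using that inj_onD[OF g _ fibre_clopen[OF f] fibre_clopen[OF h]] by (auto simp: F_def simp del: upt_Suc)
    show "f = h"
    proof (rule extensionalityI[OF funsD(3)[OF f] funsD(3)[OF h]])
      fix x assume x: "x \<in> topspace X"
      obtain i where "i \<le> n" "f x = real i / real n"
        using funsD(4)[OF f x] by (auto simp: chain_carrier)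
      then have "x \<in> {x \<in> topspace X. h x = real i / real n}" using eq[of i] x by blast
      with \<open>f x = _\<close> show "f x = h x" by simp
    qed
  qed
  then show ?thesis unfolding lepoll_def by blast
qed

end

text \<open>The algebra of functions must have its carrier in \<open>'a\<close>, so its elements are
  codes under an injection \<open>e\<close> and the pointwise operations pass through
  decoding.\<close>

locale somv_space_coded = somv_space n X V for n and X :: "'b topology" and V +
  fixes e :: "('b \<Rightarrow> real) \<Rightarrow> 'a"
  assumes inj_e: "inj_on e funs"
begin

definition dec :: "'a \<Rightarrow> 'b \<Rightarrow> real" where
  "dec = inv_into funs e"

definition alg :: "'a mv_struct" where
  "alg = \<lparr>carrier = e ` funs, mv_plus = (\<lambda>a b. e (\<lambda>x\<in>topspace X. min 1 (dec a x + dec b x))),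
     mv_neg = (\<lambda>a. e (\<lambda>x\<in>topspace X. 1 - dec a x)), mv_zero = e (\<lambda>x\<in>topspace X. 0)\<rparr>"

definition point_eval :: "'b \<Rightarrow> 'a \<Rightarrow> real" where
  "point_eval x = (\<lambda>a\<in>carrier alg. dec a x)"

lemma dec_e: "f \<in> funs \<Longrightarrow> dec (e f) = f"
  unfolding dec_def by (rule inv_into_f_f[OF inj_e])

lemma dec_mem: "a \<in> carrier alg \<Longrightarrow> dec a \<in> funs"
  unfolding dec_def alg_def by (simp add: inv_into_into)

lemma e_mem: "f \<in> funs \<Longrightarrow> e f \<in> carrier alg"
  by (simp add: alg_def)

lemma e_dec: "a \<in> carrier alg \<Longrightarrow> e (dec a) = a"
  unfolding dec_def alg_def using f_inv_into_f[of a e funs] by simp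

lemma alg_ops_mem:
  "mv_zero alg \<in> carrier alg"
  "a \<in> carrier alg \<Longrightarrow> mv_neg alg a \<in> carrier alg"
  "a \<in> carrier alg \<Longrightarrow> b \<in> carrier alg \<Longrightarrow> mv_plus alg a b \<in> carrier alg"
proof -
  show "mv_zero alg \<in> carrier alg" using e_mem[OF funs_const[of 0]] by (simp add: alg_def)
  show "mv_neg alg a \<in> carrier alg" if "a \<in> carrier alg"
    using e_mem[OF funs_neg[OF dec_mem[OF that]]] by (simp add: alg_def)
  show "mv_plus alg a b \<in> carrier alg" if "a \<in> carrier alg" "b \<in> carrier alg"
    using e_mem[OF funs_plus[OF dec_mem[OF that(1)] dec_mem[OF that(2)]]] by (simp add: alg_def)
qed

lemma dec_ops:
  assumes x: "x \<in> topspace X"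
  shows "dec (mv_zero alg) x = 0"
    "a \<in> carrier alg \<Longrightarrow> dec (mv_neg alg a) x = 1 - dec a x"
    "a \<in> carrier alg \<Longrightarrow> b \<in> carrier alg \<Longrightarrow> dec (mv_plus alg a b) x = min 1 (dec a x + dec b x)"
proof -
  show "dec (mv_zero alg) x = 0" using x by (simp add: alg_def dec_e funs_const)
  show "dec (mv_neg alg a) x = 1 - dec a x" if "a \<in> carrier alg"
    using x dec_e[OF funs_neg[OF dec_mem[OF that]]] by (simp add: alg_def)
  show "dec (mv_plus alg a b) x = min 1 (dec a x + dec b x)" if "a \<in> carrier alg" "b \<in> carrier alg"
    using x dec_e[OF funs_plus[OF dec_mem[OF that(1)] dec_mem[OF that(2)]]] by (simp add: alg_def)
qed

lemma alg_closed: "mv_closed alg"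
  unfolding mv_closed_def using alg_ops_mem by blast

lemma point_eval_hom:
  assumes x: "x \<in> topspace X"
  shows "point_eval x \<in> mv_hom alg L"
  unfolding mv_hom_def point_eval_def
  using funsD(4)[OF dec_mem x] by (auto simp: alg_ops_mem dec_ops[OF x])

lemma alg_eqI:
  assumes a: "a \<in> carrier alg" and b: "b \<in> carrier alg" and eq: "\<And>x. x \<in> topspace X \<Longrightarrow> dec a x = dec b x"
  shows "a = b"
proof -
  have "dec a = dec b"
    by (rule extensionalityI[OF funsD(3)[OF dec_mem[OF a]] funsD(3)[OF dec_mem[OF b]] eq])
  then show ?thesis using e_dec a b by metis
qed

lemma alg_mv_n1: "mv_n1_algebra n alg"
proof (rule mv_n1_algebraI[OF alg_closed, of "point_eval ` topspace X"])
  show "point_eval ` topspace X \<subseteq> mv_hom alg L" using point_eval_hom by blast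
  fix a b assume a: "a \<in> carrier alg" and b: "b \<in> carrier alg"
    and eq: "\<And>h. h \<in> point_eval ` topspace X \<Longrightarrow> h a = h b"
  show "a = b"
  proof (rule alg_eqI[OF a b])
    fix x assume "x \<in> topspace X"
    then show "dec a x = dec b x" using eq[OF imageI, of x] a b by (simp add: point_eval_def)
  qed
qed

lemma continuous_map_point_eval: "continuous_map X (hom_space alg) point_eval"
proof (rule continuous_map_into_hom_space[OF point_eval_hom])
  fix a assume a: "a \<in> carrier alg"
  note f = dec_mem[OF a]
  have "openin X {x \<in> topspace X. dec a x \<in> U}" for U
  proof -
    have "{x \<in> topspace X. dec a x \<in> U} = (\<Union>c\<in>U. {x \<in> topspace X. dec a x = c})" by blast
    also have "openin X \<dots>" using funsD(2)[OF f] by blast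
    finally show ?thesis .
  qed
  then have "continuous_map X (discrete_topology (carrier L)) (dec a)"
    using funsD(4)[OF f] by (auto simp: continuous_map_def)
  then show "continuous_map X (discrete_topology (carrier L)) (\<lambda>x. point_eval x a)"
    using a by (simp add: point_eval_def)
qed

lemma inj_on_point_eval: "inj_on point_eval (topspace X)"
proof (rule inj_onI, rule ccontr)
  fix x y assume x: "x \<in> topspace X" and y: "y \<in> topspace X" and eq: "point_eval x = point_eval y" and "x \<noteq> y"
  then obtain U where U: "openin X U" "x \<in> U" "y \<notin> U"
    using Hausdorff unfolding Hausdorff_space_def disjnt_def by blast
  then obtain C where C: "C \<in> clopens X" "x \<in> C" "C \<subseteq> U" using clopen_neighbourhood by blast
  \<comment> \<open>The indicator of \<open>C\<close>, with 1 written as \<open>n/n\<close>: for the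
    index \<open>n\<close> there is no open set in which \<open>C\<close> would have to be
    contained.\<close>
  let ?f = "\<lambda>x\<in>topspace X. if x \<in> C then real n / real n else 0"
  have f: "?f \<in> funs" by (rule funs_step[OF C(1)]) auto
  have "?f x = ?f y"
    using fun_cong[OF eq, of "e ?f"] by (simp only: point_eval_def restrict_apply e_mem[OF f] dec_e[OF f] if_True)
  moreover have "y \<notin> C" using C U by blast
  ultimately show False using C(2) x y n_pos by simp
qed

text \<open>If \<open>h\<close> is no evaluation, each point \<open>x\<close> has an element that is
  1 at \<open>x\<close> and is sent to 0 by \<open>h\<close>. By compactness the sum of finitely
  many of these is constantly 1, yet \<open>h\<close> sends it to 0.\<close>

lemma point_eval_surj:
  assumes h: "h \<in> mv_hom alg L"
  shows "h \<in> point_eval ` topspace X"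
proof (rule ccontr)
  assume nh: "h \<notin> point_eval ` topspace X"
  define Z where "Z = {b \<in> carrier alg. h b = 0}"
  define U where "U b = {x \<in> topspace X. dec b x = 1}" for b
  have "topspace X \<subseteq> \<Union>(U ` Z)"
  proof
    fix x assume x: "x \<in> topspace X"
    then have "h \<noteq> point_eval x" using nh by blast
    then obtain b where "b \<in> two_valued alg" "h b = 0" "point_eval x b = 1"
      using two_valued_separator_neq[OF alg_closed h point_eval_hom[OF x]] by blast
    then have "b \<in> Z" "x \<in> U b" using x by (auto simp: Z_def U_def two_valued_def point_eval_def)
    then show "x \<in> \<Union>(U ` Z)" by blast
  qed
  moreover have "\<forall>W\<in>U ` Z. openin X W"
    unfolding U_def Z_def using funsD(2)[OF dec_mem] by blast
  ultimately obtain \<F> where \<F>: "finite \<F>" "\<F> \<subseteq> U ` Z" "topspace X \<subseteq> \<Union>\<F>"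
    using compact unfolding compact_space_alt by meson
  from \<F>(1,2) obtain S where S: "finite S" "S \<subseteq> Z" "\<F> = U ` S" by (meson finite_subset_image)
  from S(1,2) have "\<exists>b\<in>Z. \<Union>(U ` S) \<subseteq> U b"
  proof (induction S)
    case empty
    have "mv_zero alg \<in> Z" using alg_ops_mem(1) mv_hom_chainD(1)[OF h] by (simp add: Z_def)
    then show ?case by blast
  next
    case (insert s S)
    then obtain b where b: "b \<in> Z" "\<Union>(U ` S) \<subseteq> U b" by blast
    have s: "s \<in> Z" using insert.prems by simp
    have bs: "b \<in> carrier alg" "s \<in> carrier alg" using b s by (simp_all add: Z_def)
    have "mv_plus alg s b \<in> Z"
      using b(1) s mv_hom_chainD(4)[OF h bs(2,1)] alg_ops_mem(3)[OF bs(2,1)] by (simp add: Z_def)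
    moreover have "U s \<union> U b \<subseteq> U (mv_plus alg s b)"
    proof
      fix x assume x: "x \<in> U s \<union> U b"
      then have xX: "x \<in> topspace X" by (auto simp: U_def)
      have "0 \<le> dec s x" "0 \<le> dec b x"
        using chain_bounds(1)[OF funsD(4)[OF dec_mem xX]] bs by simp_all
      with x xX dec_ops(3)[OF xX bs(2,1)] show "x \<in> U (mv_plus alg s b)" by (auto simp: U_def)
    qed
    ultimately show ?case using b(2) by (intro bexI[of _ "mv_plus alg s b"]) auto
  qed
  then obtain b where b: "b \<in> Z" and "topspace X \<subseteq> U b" using \<F>(3) S(3) by blast
  have "b = mv_neg alg (mv_zero alg)"
  proof (rule alg_eqI)
    fix x assume x: "x \<in> topspace X"
    then have "x \<in> U b" using \<open>topspace X \<subseteq> U b\<close> by blast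
    then show "dec b x = dec (mv_neg alg (mv_zero alg)) x"
      using dec_ops(2)[OF x alg_ops_mem(1)] dec_ops(1)[OF x] by (simp add: U_def)
  qed (use b alg_ops_mem in \<open>simp_all add: Z_def\<close>)
  then have "h b = 1" using mv_hom_chainD(3)[OF h alg_ops_mem(1)] mv_hom_chainD(1)[OF h] by simp
  with b show False by (simp add: Z_def)
qed

lemma homeomorphic_map_point_eval: "homeomorphic_map X (hom_space alg) point_eval"
proof (rule continuous_imp_homeomorphic_map[OF continuous_map_point_eval compact _ _ inj_on_point_eval])
  interpret separating_clopen_algebra "hom_space alg" "truth_set alg ` two_valued alg"
    by (rule hom_space_separating_clopen_algebra[OF alg_closed])
  show "Hausdorff_space (hom_space alg)" using boolean unfolding boolean_space_alt by blast
  show "point_eval ` topspace X = topspace (hom_space alg)"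
    unfolding topspace_hom_space using point_eval_hom point_eval_surj by blast
qed

text \<open>Admissibility gives one direction. For the other, \<open>V i\<close> is open, so it
  contains a clopen neighbourhood of \<open>x\<close> that carries a step function with value
  \<open>i/n\<close>.\<close>

lemma point_eval_value_iff:
  assumes x: "x \<in> topspace X" and i: "i \<in> {1..n - 1}"
  shows "(\<exists>a\<in>carrier alg. point_eval x a = real i / real n) \<longleftrightarrow> x \<in> V i"
proof
  assume "\<exists>a\<in>carrier alg. point_eval x a = real i / real n"
  then obtain a where a: "a \<in> carrier alg" "dec a x = real i / real n" by (auto simp: point_eval_def)
  then have "real i / real n \<in> admissible x" using funsD(1)[OF dec_mem[OF a(1)] x] by simp
  then show "x \<in> V i" by (simp only: admissible_iff[OF i])
next
  assume "x \<in> V i"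
  then obtain C where C: "C \<in> clopens X" "x \<in> C" "C \<subseteq> V i"
    using clopen_neighbourhood[OF V_open[OF i]] by blast
  let ?f = "\<lambda>x\<in>topspace X. if x \<in> C then real i / real n else 0"
  have f: "?f \<in> funs" by (rule funs_step[OF C(1)]) (use i C in auto)
  have "point_eval x (e ?f) = real i / real n"
    using C(2) x unfolding point_eval_def by (simp add: e_mem[OF f] dec_e[OF f])
  with e_mem[OF f] show "\<exists>a\<in>carrier alg. point_eval x a = real i / real n" by blast
qed

end

context chain_duality
begin

text \<open>Evaluation identifies \<open>X\<close> with the homomorphisms on its algebra of
  functions, \<open>pt\<close> with the coded points, and the values taken at \<open>x\<close>
  recover the open sets.\<close>

lemma dual_obj_ess_surj:
  fixes X :: "'b topology"
  assumes P: "somv_object n (X, V)" and le: "clopens X \<lesssim> (UNIV :: 'a set)" and inf: "infinite (UNIV :: 'a set)"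
  shows "\<exists>A. mv_n1_algebra n A \<and> (\<exists>f. is_iso (BoolSOMV_cat n) (X, V) (dual_obj A) f)"
proof -
  interpret somv_space n X V by standard (rule P)
  obtain e :: "('b \<Rightarrow> real) \<Rightarrow> 'a" where "inj_on e funs"
    using funs_lepoll[OF inf le] unfolding lepoll_def by blast
  then interpret somv_space_coded n X V e by unfold_locales
  have "homeomorphic_map X (sp alg) (pt alg \<circ> point_eval)"
    by (rule homeomorphic_map_compose[OF homeomorphic_map_point_eval homeomorphic_map_pt[OF alg_closed]])
  then have "is_iso (BoolSOMV_cat n) (X, V) (dual_obj alg) (restrict (pt alg \<circ> point_eval) (topspace X))"
    unfolding dual_obj_def
  proof (rule BoolSOMV_isoI)
    fix i x assume i: "i \<in> {1..n - 1}" and x: "x \<in> topspace X"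
    show "x \<in> V i \<longleftrightarrow> (pt alg \<circ> point_eval) x \<in>
      (\<lambda>i\<in>{1..n - 1}. {p \<in> pts alg. \<exists>a\<in>carrier alg. ev alg p a = real i / real n}) i"
      using i pt_mem[OF point_eval_hom[OF x]] point_eval_value_iff[OF x i] ev_pt[OF alg_closed point_eval_hom[OF x]]
      by simp
  qed
  with alg_mv_n1 show ?thesis by blast
qed

lemma dual_functor:
  "is_functor (op_cat (MV_cat n)) (full_subcat (BoolSOMV_cat n) (somv_size_at_most (UNIV :: 'a set)))
     \<lparr>on_obj = dual_obj, on_arr = dual_arr\<rparr>"
proof -
  have "dual_obj A \<in> somv_size_at_most (UNIV :: 'a set)" if "mv_closed A" for A :: "'a mv_struct"
    using clopens_sp_lepoll[OF that] by (simp add: somv_size_at_most_def dual_obj_def)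
  moreover have "dual_arr A A (restrict id (carrier A)) = Ident (BoolSOMV_cat n) (dual_obj A)"
    if "mv_closed A" for A
    using dual_arr_id[OF that] by (simp add: BoolSOMV_cat_def dual_obj_def)
  moreover have "dual_arr A C (compose (carrier C) f g) =
      Comp (BoolSOMV_cat n) (dual_obj A) (dual_obj B) (dual_obj C) (dual_arr B C g) (dual_arr A B f)"
    if "mv_closed B" "mv_closed C" "f \<in> mv_hom B A" "g \<in> mv_hom C B" for A B C f g
    using dual_arr_compose[OF that] by (simp add: BoolSOMV_cat_def dual_obj_def)
  ultimately show ?thesis
    unfolding is_functor_def op_cat_def full_subcat_def MV_cat_def
    by (simp add: mv_n1_algebra_closed dual_obj_somv dual_arr_hom BoolSOMV_cat_def)
qed

end

theorem mainTheorem5: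
  fixes n :: nat
  assumes "n \<ge> 1"
    and "infinite (UNIV :: 'a set)"
    and "(UNIV :: 'a set set) \<lesssim> (UNIV :: 'b set)"
  shows "dually_equivalent
    (MV_cat n :: ('a mv_struct, 'a \<Rightarrow> 'a) cat)
    (full_subcat (BoolSOMV_cat n) (somv_size_at_most (UNIV :: 'a set))
       :: ('b somv, 'b \<Rightarrow> 'b) cat)"
proof -
  \<comment> \<open>The room in \<open>'b\<close> for all subsets of \<open>'a\<close> is what
    allows homomorphisms to be coded as points.\<close>
  obtain code :: "'a set \<Rightarrow> 'b" where "inj code"
    using assms(3) unfolding lepoll_def by blast
  with assms(1) interpret chain_duality n code by unfold_locales
  show ?thesis
    unfolding dually_equivalent_def
  proof (rule equivalent_catsI_fully_faithful[OF is_category_op_cat[OF MV_is_category]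
        is_category_full_subcat[OF BoolSOMV_is_category] dual_functor])
    fix A B :: "'a mv_struct" and \<phi>
    assume "A \<in> Obj (op_cat (MV_cat n))" "B \<in> Obj (op_cat (MV_cat n))"
    then have A: "mv_n1_algebra n A" and B: "mv_n1_algebra n B" by (simp_all add: op_cat_def MV_cat_def)
    note cB = mv_n1_algebra_closed[OF B]
    show "\<exists>f\<in>Hom (op_cat (MV_cat n)) A B. on_arr \<lparr>on_obj = dual_obj, on_arr = dual_arr\<rparr> A B f = \<phi>"
      if "\<phi> \<in> Hom (full_subcat (BoolSOMV_cat n) (somv_size_at_most (UNIV :: 'a set)))
        (on_obj \<lparr>on_obj = dual_obj, on_arr = dual_arr\<rparr> A) (on_obj \<lparr>on_obj = dual_obj, on_arr = dual_arr\<rparr> B)"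
      using that dual_arr_full[OF A cB, of \<phi>]
      by (simp add: full_subcat_def BoolSOMV_cat_def op_cat_def MV_cat_def)
    show "inj_on (on_arr \<lparr>on_obj = dual_obj, on_arr = dual_arr\<rparr> A B) (Hom (op_cat (MV_cat n)) A B)"
      by (rule inj_onI) (simp add: op_cat_def MV_cat_def dual_arr_faithful[OF A cB])
  next
    fix P :: "'b somv"
    assume P: "P \<in> Obj (full_subcat (BoolSOMV_cat n) (somv_size_at_most (UNIV :: 'a set)))"
    obtain X V where XV: "P = (X, V)" by force
    have "somv_object n (X, V)" "clopens X \<lesssim> (UNIV :: 'a set)"
      using P by (simp_all add: XV full_subcat_def BoolSOMV_cat_def somv_size_at_most_def)
    from dual_obj_ess_surj[OF this assms(2)] obtain A f where
      "mv_n1_algebra n A" "is_iso (BoolSOMV_cat n) (X, V) (dual_obj A) f" by blast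
    \<comment> \<open>A full subcategory keeps hom-sets, identities and composition, so the
      isomorphism carries over unchanged.\<close>
    then show "\<exists>A\<in>Obj (op_cat (MV_cat n)). \<exists>f. is_iso (full_subcat (BoolSOMV_cat n) (somv_size_at_most (UNIV :: 'a set)))
        P (on_obj \<lparr>on_obj = dual_obj, on_arr = dual_arr\<rparr> A) f"
      by (auto simp: XV op_cat_def MV_cat_def is_iso_def full_subcat_def)
  qed
qed

end
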